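(* Let $X=(X,\|\cdot\|)$ be a Banach space, let $\{T(t,s): t,s\in\mathbb{R},\ t\ge s\}\subset\mathcal{B}(X)$ be an evolution family on $X$ over $\mathbb{R}$, and let $B\colon\mathbb{R}\to\mathcal{B}(X)$ be a continuous map. Suppose that $\{U(t,s): t,s\in\mathbb{R},\ t\ge s\}\subset\mathcal{B}(X)$ is an evolution family such that $$U(t,s)=T(t,s)+\int_s^t T(t,\tau)B(\tau)U(\tau,s)\,d\tau\qquad\text{for all } t\ge s.$$ Suppose that $\{T(t,s): t\ge s\}$ admits a nonuniform exponential dichotomy, and let $K,\alpha>0$ and $\varepsilon\ge 0$ be constants as in the definition of this notion for $\{T(t,s): t\ge s\}$. Assume furthermore that $$q:=2K\sup_{t\in\mathbb{R}}\int_{-\infty}^{\infty}e^{-\alpha|t-s|}\,b(s)\,ds<1,\qquad\text{where } b(t):=\|B(t)\|e^{\varepsilon|t|},\ t\in\mathbb{R}.$$ Then the evolution family $\{U(t,s): t,s\in\mathbb{R},\ t\ge s\}$ admits a nonuniform exponential dichotomy.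
   Context: $\mathcal{B}(X)$ denotes the space of all bounded linear operators on the Banach space $X$, equipped with the operator norm, also denoted by $\|\cdot\|$; $\mathrm{Id}$ is the identity operator on $X$. An evolution family on $X$ over $\mathbb{R}$ is a family $\{T(t,s): t,s\in\mathbb{R},\ t\ge s\}\subset\mathcal{B}(X)$ such that: (i) $T(t,t)=\mathrm{Id}$ for each $t\in\mathbb{R}$; (ii) $T(t,s)T(s,r)=T(t,r)$ for $t\ge s\ge r$; (iii) for every $x\in X$ and $s\in\mathbb{R}$ the map $t\mapsto T(t,s)x$ is continuous on $[s,\infty)$, and for every $x\in X$ and $t\in\mathbb{R}$ the map $s\mapsto T(t,s)x$ is continuous on $(-\infty,t]$. The operators $T(t,s)$ are not assumed to be invertible. An evolution family $\{T(t,s): t\ge s\}$ admits a nonuniform exponential dichotomy if there exist constants $K,\alpha>0$ and $\varepsilon\ge 0$ and a family $\{P(t): t\in\mathbb{R}\}\subset\mathcal{B}(X)$ of projections on $X$ such that: (1) for $t\ge s$, $T(t,s)P(s)=P(t)T(t,s)$, and the restriction $T(t,s)|_{\ker P(s)}\colon\ker P(s)\to\ker P(t)$ is an isomorphism; (2) for $t\ge s$, $\|T(t,s)P(s)\|\le Ke^{-\alpha(t-s)+\varepsilon|s|}$; (3) for $t\le s$, $\|T(t,s)(\mathrm{Id}-P(s))\|\le Ke^{-\alpha(s-t)+\varepsilon|s|}$, where for $t\le s$ one sets $T(t,s):=\left(T(s,t)|_{\ker P(t)}\right)^{-1}\colon\ker P(s)\to\ker P(t)$. The operator integral in the equation relating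 $U$ and $T$ is understood pointwise: for every $x\in X$ and $t\ge s$, $U(t,s)x=T(t,s)x+\int_s^t T(t,\tau)B(\tau)U(\tau,s)x\,d\tau$. The conclusion for $U$ means that some constants and projections as in the definition exist for $U$; they need not be the same as those for $T$. *)

theory Defs
  imports "HOL-Analysis.Analysis"
begin

text \<open>
  Only the values \<open>T t s\<close> with \<open>s \<le> t\<close> are relevant; the values for \<open>t < s\<close> are arbitrary and are
  never referred to.
\<close>

definition evolution_family :: "(real \<Rightarrow> real \<Rightarrow> ('a::banach \<Rightarrow>\<^sub>L 'a)) \<Rightarrow> bool" where
  "evolution_family T \<longleftrightarrow>
     (\<forall>t. T t t = id_blinfun) \<and>
     (\<forall>t s r. r \<le> s \<longrightarrow> s \<le> t \<longrightarrow> T t s o\<^sub>L T s r = T t r) \<and>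
     (\<forall>x s. continuous_on {s..} (\<lambda>t. blinfun_apply (T t s) x)) \<and>
     (\<forall>x t. continuous_on {..t} (\<lambda>s. blinfun_apply (T t s) x))"

definition blinfun_ker :: "('a::real_normed_vector \<Rightarrow>\<^sub>L 'b::real_normed_vector) \<Rightarrow> 'a set" where
  "blinfun_ker A = {x. blinfun_apply A x = 0}"

text \<open>
  The backward evolution from time \<open>s\<close> to time \<open>t \<le> s\<close>, i.e. the inverse of the restriction of
  \<open>T s t\<close> to the kernel of \<open>P t\<close>; it is meaningful on the kernel of \<open>P s\<close> only.
\<close>

definition backward_evolution ::
  "(real \<Rightarrow> real \<Rightarrow> ('a::banach \<Rightarrow>\<^sub>L 'a)) \<Rightarrow> (real \<Rightarrow> ('a \<Rightarrow>\<^sub>L 'a)) \<Rightarrow> real \<Rightarrow> real \<Rightarrow> 'a \<Rightarrow> 'a" where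
  "backward_evolution T P t s = inv_into (blinfun_ker (P t)) (blinfun_apply (T s t))"

text \<open>
  Isomorphisms are those of Banach spaces: linear homeomorphisms between the closed subspaces
  \<open>blinfun_ker (P s)\<close> and \<open>blinfun_ker (P t)\<close>. Hence the operator in the last clause is bounded, and
  its \<open>onorm\<close> is its operator norm.
\<close>

definition nonuniform_exp_dichotomy_wrt ::
  "(real \<Rightarrow> real \<Rightarrow> ('a::banach \<Rightarrow>\<^sub>L 'a)) \<Rightarrow> (real \<Rightarrow> ('a \<Rightarrow>\<^sub>L 'a)) \<Rightarrow> real \<Rightarrow> real \<Rightarrow> real \<Rightarrow> bool" where
  "nonuniform_exp_dichotomy_wrt T P K \<alpha> \<epsilon> \<longleftrightarrow>
     (\<forall>t. P t o\<^sub>L P t = P t) \<and>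
     (\<forall>t s. s \<le> t \<longrightarrow> T t s o\<^sub>L P s = P t o\<^sub>L T t s) \<and>
     (\<forall>t s. s \<le> t \<longrightarrow>
        (\<exists>g. homeomorphism (blinfun_ker (P s)) (blinfun_ker (P t)) (blinfun_apply (T t s)) g)) \<and>
     (\<forall>t s. s \<le> t \<longrightarrow> norm (T t s o\<^sub>L P s) \<le> K * exp (- \<alpha> * (t - s) + \<epsilon> * \<bar>s\<bar>)) \<and>
     (\<forall>t s. t \<le> s \<longrightarrow>
        onorm (\<lambda>x. backward_evolution T P t s (blinfun_apply (id_blinfun - P s) x))
          \<le> K * exp (- \<alpha> * (s - t) + \<epsilon> * \<bar>s\<bar>))"

definition nonuniform_exp_dichotomy_consts ::
  "(real \<Rightarrow> real \<Rightarrow> ('a::banach \<Rightarrow>\<^sub>L 'a)) \<Rightarrow> real \<Rightarrow> real \<Rightarrow> real \<Rightarrow> bool" where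
  "nonuniform_exp_dichotomy_consts T K \<alpha> \<epsilon> \<longleftrightarrow>
     K > 0 \<and> \<alpha> > 0 \<and> \<epsilon> \<ge> 0 \<and> (\<exists>P. nonuniform_exp_dichotomy_wrt T P K \<alpha> \<epsilon>)"

definition admits_nonuniform_exp_dichotomy ::
  "(real \<Rightarrow> real \<Rightarrow> ('a::banach \<Rightarrow>\<^sub>L 'a)) \<Rightarrow> bool" where
  "admits_nonuniform_exp_dichotomy T \<longleftrightarrow> (\<exists>K \<alpha> \<epsilon>. nonuniform_exp_dichotomy_consts T K \<alpha> \<epsilon>)"

end

theory Submission
  imports Defs
begin

text \<open>
  An exponential dichotomy of \<open>T\<close> with projections \<open>P\<close> is encoded by its Green function, which is
  \<open>T t s P s\<close> for \<open>s \<le> t\<close> and minus the backward evolution of \<open>(Id - P s)\<close> for \<open>t < s\<close>. Three algebraic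
  identities characterise Green functions, and \<open>P t = G t t\<close>. The Green function of \<open>U\<close> is obtained by
  solving \<open>f t = G t s x + \<integral> G t \<tau> (B \<tau> (f \<tau>)) d\<tau>\<close> for bounded \<open>f\<close>: the integral operator is a contraction
  both in the sup norm and under the weight \<open>exp (\<gamma> \<bar>t - s\<bar>)\<close> with \<open>\<gamma> = \<alpha> / 3\<close>. Each identity for \<open>U\<close>
  follows from uniqueness, by exhibiting a truncation of a known solution that solves the equation with
  another initial value. The weight lowers the rate \<open>\<alpha>\<close> in the kernel to \<open>2 \<alpha> / 3\<close>, which at most doubles
  the supremum in the hypothesis; this is absorbed by the factor \<open>2\<close> in \<open>q\<close>.
\<close>

section \<open>Functional analytic and integral estimates\<close>

text \<open>\<open>U\<close> cannot be run backwards, and no projection for it is at hand to split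
  the space. The whole-line equation supplies both: its solution is a bounded trajectory of
  \<open>U\<close> with a single jump, by \<open>x\<close> at time \<open>s\<close>. The value at
  \<open>s\<close> is the stable component of \<open>x\<close>, and the part before \<open>s\<close>
  is minus the backward evolution of the other component. Truncating a solution, or subtracting a
  piece of an orbit, again leaves a single jump, and by uniqueness that jump determines everything.

  For fixed \<open>s\<close> the factor \<open>exp (\<epsilon> * \<bar>s\<bar>)\<close> is a
  constant, and the same factor at the integration time is part of \<open>b\<close>; hence
  \<open>\<epsilon>\<close> does not get worse. The new constants are \<open>K / (1 - q)\<close> and
  \<open>\<alpha> / 3\<close>. Slowing the kernel from \<open>\<alpha>\<close> to
  \<open>\<beta>\<close> costs a factor \<open>1 + 2 * (\<alpha> - \<beta>) / \<beta>\<close>, which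
  is 2 exactly at \<open>\<beta> = 2 * \<alpha> / 3\<close>; what remains of the rate is the weight.

  \<open>T\<close> is only separately strongly continuous, so joint bounds on compact intervals and
  the continuity of integrals in the outer time each require an argument of their own.\<close>

text \<open>Baire: the closed sets \<open>A n\<close> of vectors on which the whole family is
  bounded by \<open>n\<close> cover the space, so one of them contains a ball.\<close>

lemma uniform_boundedness:
  fixes F :: "'i \<Rightarrow> 'a::banach \<Rightarrow>\<^sub>L 'b::real_normed_vector"
  assumes bdd: "\<And>x. \<exists>c. \<forall>i\<in>I. norm (F i x) \<le> c"
  obtains C where "\<And>i. i \<in> I \<Longrightarrow> norm (F i) \<le> C"
proof -
  define A where "A n = {x. \<forall>i\<in>I. norm (F i x) \<le> real n}" for n :: nat
  have A_closed: "closed (A n)" for n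
  proof -
    have "A n = (\<Inter>i\<in>I. {x. norm (F i x) \<le> real n})" by (auto simp: A_def)
    moreover have "closed {x. norm (F i x) \<le> real n}" for i
      by (intro closed_Collect_le continuous_intros)
    ultimately show ?thesis by auto
  qed
  have cover: "(\<Union>n. A n) = UNIV"
  proof -
    have "\<exists>n. x \<in> A n" for x
    proof -
      obtain c where c: "\<forall>i\<in>I. norm (F i x) \<le> c" using bdd by blast
      obtain n where "c \<le> real n" using real_arch_simple by blast
      then have "x \<in> A n" using c unfolding A_def mem_Collect_eq by (meson order.trans)
      then show ?thesis ..
    qed
    then show ?thesis by auto
  qed
  have "\<exists>n. interior (A n) \<noteq> {}"
  proof (rule ccontr)
    assume "\<nexists>n. interior (A n) \<noteq> {}"
    then have "euclidean interior_of \<Union>(range A) = {}"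
      using A_closed
      by (intro Baire_category_alt disjI1 completely_metrizable_space_euclidean) auto
    then show False using cover by simp
  qed
  then obtain n y where "y \<in> interior (A n)" by blast
  then obtain r where r: "r > 0" "ball y r \<subseteq> A n"
    unfolding mem_interior by blast
  \<comment> \<open>A vector of norm \<open>r / 2\<close> is a difference of two points of the ball,
    so its image has norm at most \<open>2 * n\<close>; rescaling gives
    \<open>4 * n / r\<close>.\<close>
  have "norm (F i) \<le> 4 * real n / r" if i: "i \<in> I" for i
  proof (rule norm_blinfun_bound)
    show "0 \<le> 4 * real n / r" using r by simp
    fix x
    show "norm (F i x) \<le> 4 * real n / r * norm x"
    proof (cases "x = 0")
      case False
      define c where "c = r / (2 * norm x)"
      have c: "c > 0" using False r by (simp add: c_def)
      have "y + c *\<^sub>R x \<in> A n" "y \<in> A n"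
        using r False c by (auto intro!: subsetD[OF r(2)] simp: dist_norm c_def)
      then have "norm (F i (y + c *\<^sub>R x)) \<le> n" "norm (F i y) \<le> n"
        using i by (auto simp: A_def)
      moreover have "F i (c *\<^sub>R x) = F i (y + c *\<^sub>R x) - F i y"
        by (simp add: blinfun.add_right)
      ultimately have "norm (F i (c *\<^sub>R x)) \<le> 2 * real n"
        by (metis norm_triangle_ineq4 add_mono mult_2 order_trans)
      then have "c * norm (F i x) \<le> 2 * real n"
        using c by (simp add: blinfun.scaleR_right)
      then show ?thesis using False r by (simp add: c_def field_simps)
    qed simp
  qed
  then show ?thesis using that by blast
qed

lemma compact_strongly_continuous_bounded:
  fixes F :: "'t::topological_space \<Rightarrow> 'a::banach \<Rightarrow>\<^sub>L 'b::real_normed_vector"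
  assumes "compact S" and F: "\<And>x. continuous_on S (\<lambda>t. F t x)"
  obtains C where "C > 0" "\<And>t. t \<in> S \<Longrightarrow> norm (F t) \<le> C"
proof -
  have "\<exists>c. \<forall>t\<in>S. norm (F t x) \<le> c" for x
    using compact_imp_bounded[OF compact_continuous_image[OF F \<open>compact S\<close>]]
    by (auto simp: bounded_iff)
  from uniform_boundedness[of S F, OF this] obtain C where "\<And>t. t \<in> S \<Longrightarrow> norm (F t) \<le> C"
    by metis
  then show ?thesis using that[of "max C 1"] by fastforce
qed

text \<open>Strong continuity handles a fixed vector only. After splitting \<open>F t (h t)\<close>
  at \<open>h s\<close>, the moving part \<open>h t - h s\<close> is absorbed by the uniform bound
  that compactness provides.\<close>

lemma compact_strongly_continuous_apply:
  fixes F :: "'t::topological_space \<Rightarrow> 'a::banach \<Rightarrow>\<^sub>L 'b::real_normed_vector"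
  assumes S: "compact S" and F: "\<And>x. continuous_on S (\<lambda>t. F t x)" and h: "continuous_on S h"
  shows "continuous_on S (\<lambda>t. F t (h t))"
proof -
  obtain C where C: "C > 0" "\<And>t. t \<in> S \<Longrightarrow> norm (F t) \<le> C"
    using compact_strongly_continuous_bounded[of S F] S F by blast
  show ?thesis
    unfolding continuous_on_def
  proof
    fix s assume s: "s \<in> S"
    have "((\<lambda>t. C * norm (h t - h s)) \<longlongrightarrow> C * norm (h s - h s)) (at s within S)"
      using h s by (intro tendsto_intros) (auto simp: continuous_on_def)
    then have "((\<lambda>t. C * norm (h t - h s)) \<longlongrightarrow> 0) (at s within S)" by simp
    moreover have "norm (F t (h t - h s)) \<le> C * norm (h t - h s)" if "t \<in> S" for t
      using norm_blinfun[of "F t" "h t - h s"] C(2)[OF that]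
      by (meson mult_right_mono norm_ge_zero order_trans)
    then have "\<forall>\<^sub>F t in at s within S. norm (F t (h t - h s)) \<le> C * norm (h t - h s)"
      by (simp add: eventually_at_filter)
    ultimately have "((\<lambda>t. F t (h t - h s)) \<longlongrightarrow> 0) (at s within S)"
      by (rule Lim_null_comparison[rotated])
    moreover have "((\<lambda>t. F t (h s)) \<longlongrightarrow> F s (h s)) (at s within S)"
      using F s by (auto simp: continuous_on_def)
    ultimately have "((\<lambda>t. F t (h t - h s) + F t (h s)) \<longlongrightarrow> 0 + F s (h s)) (at s within S)"
      by (rule tendsto_add)
    then show "((\<lambda>t. F t (h t)) \<longlongrightarrow> F s (h s)) (at s within S)"
      by (simp add: blinfun.diff_right)
  qed
qed

text \<open>Cauchy criterion at infinity: enlarging an interval changes the integral of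
  \<open>f\<close> by at most as much as that of \<open>h\<close>.\<close>

lemma integrable_on_UNIV_dominated:
  fixes f :: "real \<Rightarrow> 'a::banach" and h :: "real \<Rightarrow> real"
  assumes f: "\<And>a b. f integrable_on {a..b}" and h: "h integrable_on UNIV"
    and le: "\<And>x. norm (f x) \<le> h x"
  shows "f integrable_on UNIV"
proof -
  have hab: "h integrable_on {a..b}" for a b
    using h integrable_on_subinterval by blast
  have step: "norm (integral {m..n} f - integral {a..b} f) \<le> integral {m..n} h - integral {a..b} h"
    if mn: "m \<le> a" "a \<le> b" "b \<le> n" for a b m n
  proof -
    have split: "integral {m..n} g - integral {a..b} g = integral {m..a} g + integral {b..n} g"
      if g: "\<And>c d. g integrable_on {c..d}" for g :: "real \<Rightarrow> 'c::banach"
    proof -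
      have "integral {m..n} g = integral {m..a} g + (integral {a..b} g + integral {b..n} g)"
        using Henstock_Kurzweil_Integration.integral_combine[where f = g and a = m and c = a and b = n] Henstock_Kurzweil_Integration.integral_combine[where f = g and a = a and c = b and b = n] g mn by simp
      then show ?thesis by simp
    qed
    have "norm (integral {m..a} f) \<le> integral {m..a} h" "norm (integral {b..n} f) \<le> integral {b..n} h"
      by (intro integral_norm_bound_integral f hab le)+
    then show ?thesis
      unfolding split[OF f] split[OF hab] by (meson add_mono norm_triangle_ineq order_trans)
  qed
  have "\<exists>B>0. \<forall>a b c d. ball 0 B \<subseteq> {a..b} \<and> ball 0 B \<subseteq> {c..d} \<longrightarrow>
          norm (integral {a..b} f - integral {c..d} f) < e" if "e > 0" for e
  proof -
    have "\<forall>e>0. \<exists>B>0. \<forall>a b c d. ball 0 B \<subseteq> {a..b} \<and> ball 0 B \<subseteq> {c..d} \<longrightarrow>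
        norm (integral {a..b} h - integral {c..d} h) < e"
      using h unfolding integrable_alt[of h UNIV] by (simp add: cbox_interval)
    from this[rule_format, OF half_gt_zero[OF \<open>e > 0\<close>]] obtain B where B: "B > 0"
      "\<And>a b c d. ball 0 B \<subseteq> {a..b} \<Longrightarrow> ball 0 B \<subseteq> {c..d} \<Longrightarrow>
          norm (integral {a..b} h - integral {c..d} h) < e / 2"
      by blast
    have "norm (integral {a..b} f - integral {c..d} f) < e"
      if sub: "ball 0 B \<subseteq> {a..b}" "ball 0 B \<subseteq> {c..d}" for a b c d
    proof -
      \<comment> \<open>Neither interval need contain the other, so both are compared with one that
        contains the two.\<close>
      define m n where "m = min a c" and "n = max b d"
      have "a \<le> 0" "0 \<le> b" "c \<le> 0" "0 \<le> d"
        using subsetD[OF sub(1), of 0] subsetD[OF sub(2), of 0] B(1) by auto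
      moreover have mn: "ball 0 B \<subseteq> {m..n}" using sub unfolding m_def n_def by force
      ultimately have "norm (integral {m..n} f - integral {a..b} f) < e / 2"
        "norm (integral {m..n} f - integral {c..d} f) < e / 2"
        using step[of m a b n] step[of m c d n] B(2)[OF mn sub(1)] B(2)[OF mn sub(2)]
        unfolding m_def n_def real_norm_def by linarith+
      moreover have "norm (integral {a..b} f - integral {c..d} f) \<le>
          norm (integral {m..n} f - integral {a..b} f) + norm (integral {m..n} f - integral {c..d} f)"
        by (metis norm_minus_commute norm_diff_triangle_le order_refl)
      ultimately show ?thesis by linarith
    qed
    then show ?thesis using B(1) by blast
  qed
  then show ?thesis using f unfolding integrable_alt[of f UNIV] by (simp add: cbox_interval)
qed

lemma integral_apply_blinfun:
  fixes f :: "real \<Rightarrow> 'a::banach" and L :: "'a \<Rightarrow>\<^sub>L 'b::banach"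
  assumes "f integrable_on S"
  shows "(\<lambda>\<tau>. L (f \<tau>)) integrable_on S" and "integral S (\<lambda>\<tau>. L (f \<tau>)) = L (integral S f)"
  using integrable_linear[OF assms, of "blinfun_apply L"] integral_linear[OF assms, of "blinfun_apply L"]
  by (auto simp: o_def blinfun.bounded_linear_right)

section \<open>Slowing the decay of an exponential kernel\<close>

text \<open>A resolvent identity. For \<open>u \<ge> 0\<close> the part of the convolution over
  \<open>{0..u}\<close> equals \<open>(exp (- \<beta> * u) - exp (- \<alpha> * u)) / (\<alpha> -
  \<beta>)\<close> and would give equality; the rest of the line only adds to the right-hand
  side.\<close>

lemma exp_kernel_le:
  fixes \<alpha> \<beta> u :: real
  assumes "\<beta> < \<alpha>"
  shows "ennreal (exp (- \<beta> * \<bar>u\<bar>)) \<le> ennreal (exp (- \<alpha> * \<bar>u\<bar>)) +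
    ennreal (\<alpha> - \<beta>) * (\<integral>\<^sup>+ r. ennreal (exp (- \<alpha> * \<bar>u - r\<bar>) * exp (- \<beta> * \<bar>r\<bar>)) \<partial>lborel)"
proof -
  have main: "ennreal (exp (- \<beta> * \<bar>u\<bar>)) \<le> ennreal (exp (- \<alpha> * \<bar>u\<bar>)) +
    ennreal (\<alpha> - \<beta>) * (\<integral>\<^sup>+ r. ennreal (exp (- \<alpha> * \<bar>u - r\<bar>) * exp (- \<beta> * \<bar>r\<bar>)) \<partial>lborel)"
    if "u \<ge> 0" for u
  proof -
    let ?F = "\<lambda>r. exp (- \<alpha> * (u - r)) * exp (- \<beta> * r) / (\<alpha> - \<beta>)"
    have "(\<integral>\<^sup>+ r. ennreal (exp (- \<alpha> * (u - r)) * exp (- \<beta> * r)) * indicator {0..u} r \<partial>lborel)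
        = ennreal (?F u - ?F 0)"
    proof (rule nn_integral_FTC_Icc)
      fix r
      have F: "?F = (\<lambda>r. exp (- \<alpha> * u) * exp ((\<alpha> - \<beta>) * r) / (\<alpha> - \<beta>))"
        by (simp add: exp_add[symmetric] algebra_simps)
      have "exp (- \<alpha> * (u - r)) * exp (- \<beta> * r) = exp (- \<alpha> * u) * exp ((\<alpha> - \<beta>) * r)"
        by (simp add: exp_add[symmetric] algebra_simps)
      then show "(?F has_real_derivative exp (- \<alpha> * (u - r)) * exp (- \<beta> * r)) (at r)"
        unfolding F using assms by (auto intro!: derivative_eq_intros)
    qed (use that in auto)
    moreover have "(\<integral>\<^sup>+ r. ennreal (exp (- \<alpha> * (u - r)) * exp (- \<beta> * r)) * indicator {0..u} r \<partial>lborel) \<le>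
       (\<integral>\<^sup>+ r. ennreal (exp (- \<alpha> * \<bar>u - r\<bar>) * exp (- \<beta> * \<bar>r\<bar>)) \<partial>lborel)"
      by (intro nn_integral_mono) (auto split: split_indicator)
    ultimately have "ennreal (?F u - ?F 0) \<le>
       (\<integral>\<^sup>+ r. ennreal (exp (- \<alpha> * \<bar>u - r\<bar>) * exp (- \<beta> * \<bar>r\<bar>)) \<partial>lborel)"
      by (rule subst)
    then have le: "ennreal (\<alpha> - \<beta>) * ennreal (?F u - ?F 0) \<le>
       ennreal (\<alpha> - \<beta>) * (\<integral>\<^sup>+ r. ennreal (exp (- \<alpha> * \<bar>u - r\<bar>) * exp (- \<beta> * \<bar>r\<bar>)) \<partial>lborel)"
      by (rule mult_left_mono) simp
    have "exp (- \<alpha> * u) \<le> exp (- \<beta> * u)" using assms that by (simp add: mult_right_mono)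
    then have nn: "0 \<le> ?F u - ?F 0" using assms by (simp add: divide_right_mono)
    have split: "ennreal (a + d * X) = ennreal a + ennreal d * ennreal X"
      if "0 \<le> a" "0 \<le> d" "0 \<le> X" for a d X
      using that by (simp add: ennreal_mult)
    have "exp (- \<beta> * u) = exp (- \<alpha> * u) + (\<alpha> - \<beta>) * (?F u - ?F 0)"
      using assms by (simp add: diff_divide_distrib[symmetric])
    then have "ennreal (exp (- \<beta> * u)) = ennreal (exp (- \<alpha> * u)) + ennreal (\<alpha> - \<beta>) * ennreal (?F u - ?F 0)"
      using split[OF _ _ nn, of "exp (- \<alpha> * u)" "\<alpha> - \<beta>"] assms by (metis exp_ge_zero diff_ge_0_iff_ge less_imp_le)
    then show ?thesis using le that by (simp add: add_left_mono)
  qed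
  \<comment> \<open>The reflection of \<open>r\<close> reduces negative \<open>u\<close> to the case
    just treated.\<close>
  have refl: "(\<integral>\<^sup>+ r. ennreal (exp (- \<alpha> * \<bar>- u - r\<bar>) * exp (- \<beta> * \<bar>r\<bar>)) \<partial>lborel) =
     (\<integral>\<^sup>+ r. ennreal (exp (- \<alpha> * \<bar>u - r\<bar>) * exp (- \<beta> * \<bar>r\<bar>)) \<partial>lborel)"
    by (subst nn_integral_real_affine[where c = "-1" and t = 0])
      (auto intro!: nn_integral_cong simp: abs_minus_commute add.commute)
  show ?thesis
    using main[of "\<bar>u\<bar>"] refl by (cases "u \<ge> 0") auto
qed

lemma nn_integral_exp_abs:
  fixes \<beta> :: real
  assumes "\<beta> > 0"
  shows "(\<integral>\<^sup>+ r. ennreal (exp (- \<beta> * \<bar>r\<bar>)) \<partial>lborel) \<le> ennreal (2 / \<beta>)"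
proof -
  have half: "(\<integral>\<^sup>+ r. ennreal (exp (- \<beta> * r)) * indicator {0..} r \<partial>lborel) = ennreal (0 - (- exp (- \<beta> * 0) / \<beta>))"
  proof (rule nn_integral_FTC_atLeast)
    have "filterlim (\<lambda>r. - \<beta> * r) at_bot at_top"
      using assms by (intro filterlim_tendsto_neg_mult_at_bot[OF tendsto_const _ filterlim_ident]) simp
    from filterlim_compose[OF exp_at_bot this]
    have "((\<lambda>r. - exp (- \<beta> * r) / \<beta>) \<longlongrightarrow> - 0 / \<beta>) at_top"
      using assms by (intro tendsto_intros) auto
    then show "((\<lambda>r. - exp (- \<beta> * r) / \<beta>) \<longlongrightarrow> 0) at_top" by simp
  qed (use assms in \<open>auto intro!: derivative_eq_intros simp: field_simps\<close>)
  have half': "(\<integral>\<^sup>+ r. ennreal (exp (\<beta> * r)) * indicator {..0} r \<partial>lborel) =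
      (\<integral>\<^sup>+ r. ennreal (exp (- \<beta> * r)) * indicator {0..} r \<partial>lborel)"
    by (subst nn_integral_real_affine[where c = "-1" and t = 0])
      (auto intro!: nn_integral_cong split: split_indicator)
  have "(\<integral>\<^sup>+ r. ennreal (exp (- \<beta> * \<bar>r\<bar>)) \<partial>lborel) \<le>
      (\<integral>\<^sup>+ r. ennreal (exp (- \<beta> * r)) * indicator {0..} r + ennreal (exp (\<beta> * r)) * indicator {..0} r \<partial>lborel)"
    by (intro nn_integral_mono) (auto split: split_indicator)
  also have "\<dots> = ennreal (1 / \<beta>) + ennreal (1 / \<beta>)"
    by (subst nn_integral_add) (use half half' in auto)
  also have "\<dots> = ennreal (2 / \<beta>)"
    using assms by (subst ennreal_plus[symmetric]) auto
  finally show ?thesis .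
qed

text \<open>Integrating \<open>exp_kernel_le\<close> against \<open>b\<close> leaves
  \<open>M\<close> plus a double integral. Tonelli turns its inner part into the hypothesis at a
  shifted time, uniformly bounded by \<open>M\<close>, and its outer part into the mass
  \<open>2 / \<beta>\<close> of the slow kernel.\<close>

lemma exp_convolution_le:
  fixes \<alpha> \<beta> :: real and b :: "real \<Rightarrow> real" and M :: ennreal
  assumes \<beta>: "0 < \<beta>" "\<beta> < \<alpha>" and b [measurable]: "b \<in> borel_measurable borel" and nn: "\<And>s. b s \<ge> 0"
    and M: "\<And>t. (\<integral>\<^sup>+ s. ennreal (exp (- \<alpha> * \<bar>t - s\<bar>) * b s) \<partial>lborel) \<le> M"
  shows "(\<integral>\<^sup>+ s. ennreal (exp (- \<beta> * \<bar>t - s\<bar>) * b s) \<partial>lborel) \<le> ennreal (1 + 2 * (\<alpha> - \<beta>) / \<beta>) * M"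
proof -
  let ?J = "\<lambda>s. \<integral>\<^sup>+ r. ennreal (exp (- \<alpha> * \<bar>(t - s) - r\<bar>) * exp (- \<beta> * \<bar>r\<bar>)) \<partial>lborel"
  have "(\<integral>\<^sup>+ s. ?J s * ennreal (b s) \<partial>lborel) =
      (\<integral>\<^sup>+ s. \<integral>\<^sup>+ r. ennreal (exp (- \<alpha> * \<bar>(t - s) - r\<bar>) * exp (- \<beta> * \<bar>r\<bar>)) * ennreal (b s) \<partial>lborel \<partial>lborel)"
    by (intro nn_integral_cong) (simp add: nn_integral_multc)
  also have "\<dots> = (\<integral>\<^sup>+ r. \<integral>\<^sup>+ s. ennreal (exp (- \<alpha> * \<bar>(t - s) - r\<bar>) * exp (- \<beta> * \<bar>r\<bar>)) * ennreal (b s) \<partial>lborel \<partial>lborel)"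
    by (rule lborel_pair.Fubini') simp
  \<comment> \<open>With \<open>r\<close> fixed, the integral over \<open>s\<close> is that of the
    hypothesis at time \<open>t - r\<close>.\<close>
  also have "\<dots> = (\<integral>\<^sup>+ r. ennreal (exp (- \<beta> * \<bar>r\<bar>)) *
      (\<integral>\<^sup>+ s. ennreal (exp (- \<alpha> * \<bar>(t - r) - s\<bar>) * b s) \<partial>lborel) \<partial>lborel)"
    by (intro nn_integral_cong, subst nn_integral_cmult[symmetric])
      (auto intro!: nn_integral_cong simp: nn ennreal_mult'' mult_ac algebra_simps)
  also have "\<dots> \<le> (\<integral>\<^sup>+ r. ennreal (exp (- \<beta> * \<bar>r\<bar>)) * M \<partial>lborel)"
    by (intro nn_integral_mono mult_left_mono M) auto
  also have "\<dots> = (\<integral>\<^sup>+ r. ennreal (exp (- \<beta> * \<bar>r\<bar>)) \<partial>lborel) * M"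
    by (simp add: nn_integral_multc)
  also have "\<dots> \<le> ennreal (2 / \<beta>) * M"
    by (intro mult_right_mono nn_integral_exp_abs \<beta>) auto
  finally have J: "(\<integral>\<^sup>+ s. ?J s * ennreal (b s) \<partial>lborel) \<le> ennreal (2 / \<beta>) * M" .
  have "(\<integral>\<^sup>+ s. ennreal (exp (- \<beta> * \<bar>t - s\<bar>) * b s) \<partial>lborel) =
      (\<integral>\<^sup>+ s. ennreal (exp (- \<beta> * \<bar>t - s\<bar>)) * ennreal (b s) \<partial>lborel)"
    by (simp add: nn ennreal_mult'')
  also have "\<dots> \<le> (\<integral>\<^sup>+ s. (ennreal (exp (- \<alpha> * \<bar>t - s\<bar>)) + ennreal (\<alpha> - \<beta>) * ?J s) * ennreal (b s) \<partial>lborel)"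
    by (intro nn_integral_mono mult_right_mono exp_kernel_le \<beta>) auto
  also have "\<dots> = (\<integral>\<^sup>+ s. ennreal (exp (- \<alpha> * \<bar>t - s\<bar>) * b s) + ennreal (\<alpha> - \<beta>) * (?J s * ennreal (b s)) \<partial>lborel)"
    by (simp add: nn ennreal_mult'' distrib_right mult.assoc)
  also have "\<dots> = (\<integral>\<^sup>+ s. ennreal (exp (- \<alpha> * \<bar>t - s\<bar>) * b s) \<partial>lborel) +
      ennreal (\<alpha> - \<beta>) * (\<integral>\<^sup>+ s. ?J s * ennreal (b s) \<partial>lborel)"
    by (simp add: nn_integral_add nn_integral_cmult)
  also have "\<dots> \<le> M + ennreal (\<alpha> - \<beta>) * (ennreal (2 / \<beta>) * M)"
    by (intro add_mono M mult_left_mono J) auto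
  also have "\<dots> = (ennreal 1 + ennreal (\<alpha> - \<beta>) * ennreal (2 / \<beta>)) * M"
    by (simp add: distrib_right mult.assoc)
  also have "ennreal 1 + ennreal (\<alpha> - \<beta>) * ennreal (2 / \<beta>) = ennreal (1 + 2 * (\<alpha> - \<beta>) / \<beta>)"
    using \<beta> by (subst ennreal_mult''[symmetric], simp, subst ennreal_plus[symmetric]) (auto simp: mult.commute)
  finally show ?thesis .
qed

section \<open>Green functions of evolution families\<close>

text \<open>
  For a dichotomy, \<open>G t s\<close> jumps by the identity at \<open>t = s\<close>, so the parenthesis in the second clause is
  \<open>G s t\<close> with its value at \<open>s = t\<close> replaced by the left limit.
\<close>

definition green_function ::
  "(real \<Rightarrow> real \<Rightarrow> ('a::banach \<Rightarrow>\<^sub>L 'a)) \<Rightarrow> (real \<Rightarrow> real \<Rightarrow> ('a \<Rightarrow>\<^sub>L 'a)) \<Rightarrow> bool" where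
  "green_function T G \<longleftrightarrow>
     (\<forall>r t s. r \<le> t \<longrightarrow>
        G t s = (T t r o\<^sub>L G r s) + (if r < s \<and> s \<le> t then T t s else 0)) \<and>
     (\<forall>r s t. G r s o\<^sub>L (G s t - (if s = t then id_blinfun else 0)) =
        (of_bool (t < s) - of_bool (r < s)) *\<^sub>R G r t) \<and>
     (\<forall>r s t. s \<le> t \<longrightarrow>
        G r t o\<^sub>L T t s = G r s - (if s \<le> r \<and> r < t then T r s else 0))"

text \<open>On the diagonal the first clause bounds only the projection \<open>G s s\<close>. The
  second clause bounds the complementary projection, which is minus the left limit of the Green
  function at the jump.\<close>

definition green_bound :: "(real \<Rightarrow> real \<Rightarrow> ('a::banach \<Rightarrow>\<^sub>L 'a)) \<Rightarrow> real \<Rightarrow> real \<Rightarrow> real \<Rightarrow> bool" where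
  "green_bound G K \<alpha> \<epsilon> \<longleftrightarrow>
     (\<forall>t s. norm (G t s) \<le> K * exp (- \<alpha> * \<bar>t - s\<bar> + \<epsilon> * \<bar>s\<bar>)) \<and>
     (\<forall>s. norm (id_blinfun - G s s) \<le> K * exp (\<epsilon> * \<bar>s\<bar>))"

lemma green_functionD:
  assumes "green_function T G"
  shows "\<And>r s t x. r \<le> t \<Longrightarrow> G t s x = T t r (G r s x) + (if r < s \<and> s \<le> t then T t s x else 0)"
    and "\<And>r s t x. G r s (G s t x - (if s = t then x else 0)) =
        (of_bool (t < s) - of_bool (r < s)) *\<^sub>R G r t x"
    and "\<And>r s t x. s \<le> t \<Longrightarrow> G r t (T t s x) = G r s x - (if s \<le> r \<and> r < t then T r s x else 0)"
proof -
  fix r s t x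
  show "G t s x = T t r (G r s x) + (if r < s \<and> s \<le> t then T t s x else 0)" if "r \<le> t"
  proof -
    have "G t s = (T t r o\<^sub>L G r s) + (if r < s \<and> s \<le> t then T t s else 0)"
      using assms that unfolding green_function_def by blast
    from arg_cong[OF this, of "\<lambda>L. blinfun_apply L x"] show ?thesis
      by (simp add: blinfun.bilinear_simps split: if_splits)
  qed
  show "G r s (G s t x - (if s = t then x else 0)) = (of_bool (t < s) - of_bool (r < s)) *\<^sub>R G r t x"
  proof -
    have "G r s o\<^sub>L (G s t - (if s = t then id_blinfun else 0)) = (of_bool (t < s) - of_bool (r < s)) *\<^sub>R G r t"
      using assms unfolding green_function_def by blast
    from arg_cong[OF this, of "\<lambda>L. blinfun_apply L x"] show ?thesis
      by (simp add: blinfun.bilinear_simps of_bool_def split: if_splits)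
  qed
  show "G r t (T t s x) = G r s x - (if s \<le> r \<and> r < t then T r s x else 0)" if "s \<le> t"
  proof -
    have "G r t o\<^sub>L T t s = G r s - (if s \<le> r \<and> r < t then T r s else 0)"
      using assms that unfolding green_function_def by blast
    from arg_cong[OF this, of "\<lambda>L. blinfun_apply L x"] show ?thesis
      by (simp add: blinfun.bilinear_simps split: if_splits)
  qed
qed

lemma green_functionI:
  fixes T G :: "real \<Rightarrow> real \<Rightarrow> ('a::banach \<Rightarrow>\<^sub>L 'a)"
  assumes "\<And>r s t x. r \<le> t \<Longrightarrow> G t s x = T t r (G r s x) + (if r < s \<and> s \<le> t then T t s x else 0)"
    and "\<And>r s t x. G r s (G s t x - (if s = t then x else 0)) =
        (of_bool (t < s) - of_bool (r < s)) *\<^sub>R G r t x"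
    and "\<And>r s t x. s \<le> t \<Longrightarrow> G r t (T t s x) = G r s x - (if s \<le> r \<and> r < t then T r s x else 0)"
  shows "green_function T G"
  unfolding green_function_def
proof (intro conjI allI impI blinfun_eqI)
  fix r s t x
  show "(G r s o\<^sub>L (G s t - (if s = t then id_blinfun else 0))) x =
      ((of_bool (t < s) - of_bool (r < s)) *\<^sub>R G r t) x"
    using assms(2)[of r s t x] by (simp add: blinfun.bilinear_simps of_bool_def split: if_splits)
  show "G t s x = ((T t r o\<^sub>L G r s) + (if r < s \<and> s \<le> t then T t s else 0)) x" if "r \<le> t"
    using assms(1)[OF that, of s x] by (simp add: blinfun.bilinear_simps split: if_splits)
  show "(G r t o\<^sub>L T t s) x = (G r s - (if s \<le> r \<and> r < t then T r s else 0)) x" if "s \<le> t"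
    using assms(3)[OF that, of r x] by (simp add: blinfun.bilinear_simps split: if_splits)
qed

lemma evolution_familyD:
  assumes "evolution_family T"
  shows "T t t x = x"
    and "r \<le> s \<Longrightarrow> s \<le> t \<Longrightarrow> T t s (T s r x) = T t r x"
    and "continuous_on {s..} (\<lambda>t. T t s x)"
    and "continuous_on {..t} (\<lambda>s. T t s x)"
proof -
  show "T t t x = x" "continuous_on {s..} (\<lambda>t. T t s x)" "continuous_on {..t} (\<lambda>s. T t s x)"
    using assms unfolding evolution_family_def by simp_all
  show "T t s (T s r x) = T t r x" if "r \<le> s" "s \<le> t"
    using assms that unfolding evolution_family_def by (metis blinfun_apply_blinfun_compose)
qed

text \<open>The dichotomy provides the inverse on kernels only as a homeomorphism, while a Green
  function consists of bounded operators. A ball of radius \<open>d\<close> mapped into the unit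
  ball gives the bound by scaling.\<close>

lemma linear_continuous_imp_bounded_linear:
  fixes f :: "'a::real_normed_vector \<Rightarrow> 'b::real_normed_vector"
  assumes "linear f" and "isCont f 0"
  shows "bounded_linear f"
proof -
  interpret linear f by fact
  obtain d where d: "d > 0" "\<And>x. norm x < d \<Longrightarrow> norm (f x) < 1"
    using \<open>isCont f 0\<close>[unfolded continuous_at_eps_delta, rule_format, of 1] by (auto simp: zero)
  have "norm (f x) \<le> norm x * (2 / d)" for x
  proof (cases "x = 0")
    case False
    define c where "c = d / (2 * norm x)"
    have c: "c > 0" using d False by (simp add: c_def)
    have "norm (c *\<^sub>R x) < d" using False d by (simp add: c_def)
    then have "c * norm (f x) < 1" using d(2)[of "c *\<^sub>R x"] c by (simp add: scale)
    then show ?thesis using False d by (simp add: c_def field_simps)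
  qed (simp add: zero)
  then show ?thesis
    by (intro bounded_linear_intro[where K = "2 / d"]) (auto simp: add scale)
qed

text \<open>\<open>R t s x\<close> is the only vector of the kernel of \<open>P t\<close> that
  \<open>T s t\<close> sends to \<open>Q s x\<close>. The properties of the backward evolution
  follow by checking these two conditions.\<close>

lemma dichotomy_imp_green_function:
  fixes T :: "real \<Rightarrow> real \<Rightarrow> ('a::banach \<Rightarrow>\<^sub>L 'a)"
  assumes ev: "evolution_family T" and dich: "nonuniform_exp_dichotomy_wrt T P K \<alpha> \<epsilon>"
  obtains G where "green_function T G" and "green_bound G K \<alpha> \<epsilon>"
proof -
  note T = evolution_familyD[OF ev]
  define Q where "Q s = id_blinfun - P s" for s
  define R where "R t s x = backward_evolution T P t s (Q s x)" for t s x
  define G where "G t s = (if s \<le> t then T t s o\<^sub>L P s else - Blinfun (R t s))" for t s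
  have "\<And>t. P t o\<^sub>L P t = P t" and "\<And>t s. s \<le> t \<Longrightarrow> T t s o\<^sub>L P s = P t o\<^sub>L T t s"
    using dich unfolding nonuniform_exp_dichotomy_wrt_def by auto
  then have PP: "P t (P t x) = P t x" and TP: "s \<le> t \<Longrightarrow> P t (T t s x) = T t s (P s x)" for t s x
    by (metis blinfun_apply_blinfun_compose)+
  have Q: "Q t x = x - P t x" for t x by (simp add: Q_def blinfun.diff_left)
  have PQ: "P t (Q t x) = 0" for t x by (simp add: Q blinfun.diff_right PP)
  have hom: "\<exists>g. homeomorphism (blinfun_ker (P s)) (blinfun_ker (P t)) (T t s) g" if "s \<le> t" for s t
    using dich that unfolding nonuniform_exp_dichotomy_wrt_def by blast
  have PR: "P t (R t s x) = 0" and TR: "T s t (R t s x) = Q s x" if ts: "t \<le> s" for t s x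
  proof -
    obtain g where g: "homeomorphism (blinfun_ker (P t)) (blinfun_ker (P s)) (T s t) g"
      using hom[OF ts] by blast
    then have "Q s x \<in> T s t ` blinfun_ker (P t)"
      using homeomorphism_image1[OF g] PQ by (auto simp: blinfun_ker_def)
    from inv_into_into[OF this] f_inv_into_f[OF this]
    show "P t (R t s x) = 0" "T s t (R t s x) = Q s x"
      by (auto simp: R_def backward_evolution_def blinfun_ker_def)
  qed
  have ker_eq: "y = z" if "t \<le> s" "P t y = 0" "P t z = 0" "T s t y = T s t z" for t s y z
  proof -
    obtain g where g: "homeomorphism (blinfun_ker (P t)) (blinfun_ker (P s)) (T s t) g"
      using hom[OF \<open>t \<le> s\<close>] by blast
    have y: "g (T s t y) = y" and z: "g (T s t z) = z"
      by (rule homeomorphism_apply1[OF g], simp add: blinfun_ker_def that)+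
    show ?thesis by (rule trans[OF y[symmetric] trans[OF arg_cong[OF that(4), of g] z]])
  qed
  \<comment> \<open>The characterisation of \<open>R\<close> on which the linearity, the cocycle
    rules and the Green identities rest.\<close>
  have RI: "R t s x = y" if "t \<le> s" "P t y = 0" "T s t y = Q s x" for t s x y
    using ker_eq[of t s "R t s x" y] PR TR that by simp
  have R_bl: "bounded_linear (R t s)" if ts: "t \<le> s" for t s
  proof (rule linear_continuous_imp_bounded_linear)
    show "linear (R t s)"
      by (rule linearI; rule RI[OF ts])
        (simp_all add: blinfun.bilinear_simps PR[OF ts] TR[OF ts])
    obtain g where g: "homeomorphism (blinfun_ker (P t)) (blinfun_ker (P s)) (T s t) g"
      using hom[OF ts] by blast
    have "R t s = (\<lambda>x. g (Q s x))"
      by (rule ext, rule RI[OF ts])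
        (use g PQ in \<open>auto simp: blinfun_ker_def homeomorphism_def\<close>)
    moreover have "continuous_on UNIV (\<lambda>x. g (Q s x))"
      by (rule continuous_on_compose2[OF homeomorphism_cont2[OF g]])
        (auto intro!: continuous_intros simp: blinfun_ker_def PQ)
    ultimately show "isCont (R t s) 0" by (simp add: continuous_on_eq_continuous_at)
  qed
  have G: "G t s x = (if s \<le> t then T t s (P s x) else - R t s x)" for t s x
    by (simp add: G_def blinfun.minus_left bounded_linear_Blinfun_apply[OF R_bl])
  have Rss: "R s s x = Q s x" for s x
    by (rule RI) (simp_all add: PQ T)
  have TQ: "s \<le> t \<Longrightarrow> Q t (T t s x) = T t s (Q s x)" for t s x
    by (simp add: Q TP blinfun.diff_right)
  have TR': "T t r (R r s x) = R t s x" if "r \<le> t" "t \<le> s" for r t s x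
    by (rule RI[symmetric]) (use that in \<open>auto simp: TP PR TR T(2)\<close>)
  have green: "green_function T G"
  proof (rule green_functionI)
    fix r s t x
    show "G t s x = T t r (G r s x) + (if r < s \<and> s \<le> t then T t s x else 0)" if "r \<le> t"
    proof -
      have "T t r (R r s x) = T t s x - T t s (P s x)" if "r < s" "s \<le> t"
        using TR[of r s x] T(2)[of r s t "R r s x"] that by (simp add: Q blinfun.diff_right)
      then show ?thesis
        using that by (auto simp: G T(2) blinfun.minus_right TR')
    qed
    show "G r t (T t s x) = G r s x - (if s \<le> r \<and> r < t then T r s x else 0)" if "s \<le> t"
    proof -
      have "R r t (T t s x) = T r s (Q s x)" if "s \<le> r" "r < t"
        by (rule RI) (use that \<open>s \<le> t\<close> in \<open>auto simp: TP PQ TQ T(2)\<close>)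
      moreover have "R r t (T t s x) = R r s x" if "r < s"
        by (rule RI) (use that \<open>s \<le> t\<close> T(2)[of r s t "R r s x"] in \<open>auto simp: PR TQ TR\<close>)
      ultimately show ?thesis
        using that by (auto simp: G TP T(2) Q blinfun.diff_right)
    qed
    \<comment> \<open>For \<open>t < s\<close> the bracket lies in the range of \<open>P s\<close>,
      where backward evolution vanishes; otherwise it is \<open>- R s t x\<close>, in the kernel of
      \<open>P s\<close>, which the forward part annihilates.\<close>
    show "G r s (G s t x - (if s = t then x else 0)) = (of_bool (t < s) - of_bool (r < s)) *\<^sub>R G r t x"
    proof (cases "t < s")
      case True
      define y where "y = T s t (P t x)"
      have y: "G s t x - (if s = t then x else 0) = y" "P s y = y"
        using True by (auto simp: G y_def TP PP)
      have "R r s y = 0" if "r < s"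
        by (rule RI) (use that y in \<open>auto simp: Q\<close>)
      then show ?thesis
        unfolding y(1) using True y by (auto simp: G y_def T(2))
    next
      case False
      then have y: "G s t x - (if s = t then x else 0) = - R s t x"
        using Rss by (auto simp: G T(1) Q)
      have "R r s (R s t x) = R r t x" if "r < s"
        by (rule RI) (use that False in \<open>auto simp: PR TR' Q\<close>)
      then show ?thesis
        unfolding y using False by (auto simp: G PR blinfun.minus_right linear_neg[OF bounded_linear.linear[OF R_bl]])
    qed
  qed
  have "green_bound G K \<alpha> \<epsilon>"
    unfolding green_bound_def
  proof (intro conjI allI)
    have onorm_R: "onorm (R t s) \<le> K * exp (- \<alpha> * (s - t) + \<epsilon> * \<bar>s\<bar>)" if "t \<le> s" for t s
      using dich that unfolding nonuniform_exp_dichotomy_wrt_def R_def[abs_def] Q_def by blast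
    fix t s
    show "norm (G t s) \<le> K * exp (- \<alpha> * \<bar>t - s\<bar> + \<epsilon> * \<bar>s\<bar>)"
    proof (cases "s \<le> t")
      case True
      then show ?thesis
        using dich unfolding nonuniform_exp_dichotomy_wrt_def by (auto simp: G_def)
    next
      case False
      then have "norm (G t s) = norm (Blinfun (R t s))" by (simp add: G_def)
      with False have "norm (G t s) = onorm (R t s)"
        by (simp add: norm_blinfun.rep_eq bounded_linear_Blinfun_apply[OF R_bl])
      then show ?thesis using onorm_R[of t s] False by simp
    qed
    \<comment> \<open>The diagonal bound is the backward estimate of the dichotomy at equal
      times.\<close>
    have "id_blinfun - G s s = Blinfun (R s s)"
      by (rule blinfun_eqI)
        (simp add: blinfun.diff_left bounded_linear_Blinfun_apply[OF R_bl] Rss Q G T(1))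
    then have "norm (id_blinfun - G s s) = onorm (R s s)"
      by (simp add: norm_blinfun.rep_eq bounded_linear_Blinfun_apply[OF R_bl])
    then show "norm (id_blinfun - G s s) \<le> K * exp (\<epsilon> * \<bar>s\<bar>)" using onorm_R[of s s] by simp
  qed
  with green show ?thesis using that by blast
qed

text \<open>All data are read off from \<open>G\<close>: idempotence of \<open>G t t\<close> is the
  second identity at equal times, and for \<open>s < t\<close> the first and third identities say
  that \<open>- G s t\<close> inverts \<open>U t s\<close> between the kernels.\<close>

lemma green_function_imp_dichotomy:
  fixes U :: "real \<Rightarrow> real \<Rightarrow> ('a::banach \<Rightarrow>\<^sub>L 'a)"
  assumes ev: "evolution_family U" and green: "green_function U G"
    and bound: "green_bound G K \<alpha> \<epsilon>"
  shows "nonuniform_exp_dichotomy_wrt U (\<lambda>t. G t t) K \<alpha> \<epsilon>"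
proof -
  note U = evolution_familyD[OF ev] and G = green_functionD[OF green]
  have UP: "U t s (G s s x) = G t s x" if "s \<le> t" for t s x
    using G(1)[of s t s x] that by simp
  have PU: "G t t (U t s x) = G t s x" if "s \<le> t" for t s x
    using G(3)[of s t t x] that by simp
  have PP: "G t t (G t t x) = G t t x" for t x
    using G(2)[of t t t x] by (simp add: blinfun.diff_right)
  have PG: "G t t (G t s x) = 0" if "t < s" for t s x
    using G(2)[of t t s x] that by simp
  have UG: "U t s (G s t x) = G t t x - x" if "s < t" for t s x
    using G(1)[of s t t x] that by (simp add: U(1))
  have GU: "G s t (U t s x) = G s s x - x" if "s < t" for t s x
    using G(3)[of s t s x] that by (simp add: U(1))
  \<comment> \<open>On the diagonal \<open>- G t t\<close> would vanish on the kernel, because of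
    the jump; the identity must be put there by hand.\<close>
  define V where "V t s x = (if s = t then x else - G t s x)" for t s x
  have hom: "homeomorphism (blinfun_ker (G s s)) (blinfun_ker (G t t)) (U t s) (V s t)" if st: "s \<le> t" for s t
  proof (rule homeomorphismI)
    have "V s t = (if s = t then (\<lambda>x. x) else (\<lambda>x. - G s t x))"
      by (auto simp: V_def)
    then show "continuous_on (blinfun_ker (G t t)) (V s t)"
      by (auto intro!: continuous_intros)
    show "continuous_on (blinfun_ker (G s s)) (U t s)" by (intro continuous_intros)
    show "U t s ` blinfun_ker (G s s) \<subseteq> blinfun_ker (G t t)"
      using UP[OF st] PU[OF st] by (auto simp: blinfun_ker_def) (metis blinfun.zero_right)
    show "V s t ` blinfun_ker (G t t) \<subseteq> blinfun_ker (G s s)"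
      using PG[of s t] st by (auto simp: blinfun_ker_def V_def blinfun.minus_right)
    show "V s t (U t s x) = x" if "x \<in> blinfun_ker (G s s)" for x
      using GU[of s t x] st that by (auto simp: blinfun_ker_def V_def U(1))
    show "U t s (V s t x) = x" if "x \<in> blinfun_ker (G t t)" for x
      using UG[of s t x] st that by (auto simp: blinfun_ker_def V_def U(1) blinfun.minus_right)
  qed
  show ?thesis
    unfolding nonuniform_exp_dichotomy_wrt_def
  proof (intro conjI allI impI)
    show "G t t o\<^sub>L G t t = G t t" for t by (rule blinfun_eqI) (simp add: PP)
    fix t s :: real
    show "U t s o\<^sub>L G s s = G t t o\<^sub>L U t s" if "s \<le> t"
      by (rule blinfun_eqI) (simp add: UP PU that)
    show "\<exists>g. homeomorphism (blinfun_ker (G s s)) (blinfun_ker (G t t)) (U t s) g" if "s \<le> t"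
      using hom[OF that] by blast
    show "norm (U t s o\<^sub>L G s s) \<le> K * exp (- \<alpha> * (t - s) + \<epsilon> * \<bar>s\<bar>)" if "s \<le> t"
    proof -
      have "U t s o\<^sub>L G s s = G t s" by (rule blinfun_eqI) (simp add: UP that)
      moreover have "norm (G t s) \<le> K * exp (- \<alpha> * \<bar>t - s\<bar> + \<epsilon> * \<bar>s\<bar>)"
        using bound unfolding green_bound_def by blast
      ultimately show ?thesis using that by simp
    qed
    show "onorm (\<lambda>x. backward_evolution U (\<lambda>t. G t t) t s ((id_blinfun - G s s) x))
        \<le> K * exp (- \<alpha> * (s - t) + \<epsilon> * \<bar>s\<bar>)" if "t \<le> s"
    proof -
      let ?W = "if s = t then id_blinfun - G s s else - G t s"
      have "backward_evolution U (\<lambda>t. G t t) t s ((id_blinfun - G s s) x) = ?W x" for x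
      proof -
        let ?y = "(id_blinfun - G s s) x"
        have y: "?y \<in> blinfun_ker (G s s)"
          by (simp add: blinfun_ker_def blinfun.diff_left blinfun.diff_right PP)
        have "U s t (V t s ?y) = ?y" "V t s ?y \<in> blinfun_ker (G t t)"
          using homeomorphism_apply2[OF hom[OF that] y] homeomorphism_image2[OF hom[OF that]] y by auto
        moreover have "inj_on (U s t) (blinfun_ker (G t t))"
          using homeomorphism_apply1[OF hom[OF that]] by (rule inj_on_inverseI)
        ultimately have "backward_evolution U (\<lambda>t. G t t) t s ?y = V t s ?y"
          unfolding backward_evolution_def by (metis inv_into_f_eq)
        \<comment> \<open>For \<open>t < s\<close> the second identity gives \<open>G t s\<close>
          composed with \<open>id_blinfun - G s s\<close> equal to \<open>G t s\<close>, so the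
          projection in front disappears.\<close>
        also have "V t s ?y = ?W x"
        proof (cases "s = t")
          case False
          then show ?thesis
            using G(2)[of t s s x] that
            by (simp add: V_def blinfun.minus_left blinfun.diff_left blinfun.diff_right)
        qed (simp add: V_def)
        finally show ?thesis .
      qed
      then have "onorm (\<lambda>x. backward_evolution U (\<lambda>t. G t t) t s ((id_blinfun - G s s) x)) = norm ?W"
        by (simp add: norm_blinfun.rep_eq)
      moreover have "norm ?W \<le> K * exp (- \<alpha> * \<bar>t - s\<bar> + \<epsilon> * \<bar>s\<bar>)"
        using bound unfolding green_bound_def by auto
      ultimately show ?thesis using that by simp
    qed
  qed
qed

section \<open>Perturbation of the Green function\<close>

text \<open>Comparison with an exact orbit started at a fixed time \<open>s\<close> strictly before
  \<open>x\<close>: this orbit is continuous on both sides of \<open>x\<close>, which also settles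
  left continuity without joint continuity of \<open>T\<close>.\<close>

lemma approximate_evolution_continuous:
  fixes T :: "real \<Rightarrow> real \<Rightarrow> ('a::banach \<Rightarrow>\<^sub>L 'a)"
  assumes ev: "evolution_family T" and x: "a < x" "x < b" and C: "C > 0"
    and F: "\<And>s t. a \<le> s \<Longrightarrow> s \<le> t \<Longrightarrow> t \<le> b \<Longrightarrow> norm (F t - T t s (F s)) \<le> C * (t - s)"
  shows "isCont F x"
  unfolding continuous_at_eps_delta
proof (intro allI impI)
  fix e :: real assume "e > 0"
  \<comment> \<open>Error budget: \<open>e / 6\<close> for the defect at \<open>x\<close>,
    \<open>e / 3\<close> for the defect at \<open>t\<close>, and \<open>e / 3\<close> for the motion
    of the orbit.\<close>
  define s where "s = max ((a + x) / 2) (x - e / (6 * C))"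
  have s: "a \<le> s" "s < x" "C * (x - s) \<le> e / 6"
    using x C \<open>e > 0\<close> by (auto simp: s_def max_def field_simps)
  have "isCont (\<lambda>t. T t s (F s)) x"
  proof (rule continuous_on_interior)
    show "continuous_on {s..} (\<lambda>t. T t s (F s))" using evolution_familyD(3)[OF ev] .
    show "x \<in> interior {s..}" using s by simp
  qed
  then obtain d where d: "d > 0" "\<And>t. \<bar>t - x\<bar> < d \<Longrightarrow> norm (T t s (F s) - T x s (F s)) < e / 3"
    unfolding continuous_at_eps_delta using \<open>e > 0\<close> by (metis dist_norm divide_pos_pos real_norm_def zero_less_numeral)
  define d' where "d' = Min {d, x - s, b - x, e / (6 * C)}"
  have d': "d' > 0" "d' \<le> d" "d' \<le> x - s" "d' \<le> b - x" "d' \<le> e / (6 * C)"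
    using d(1) s x C \<open>e > 0\<close> by (auto simp: d'_def)
  have "norm (F t - F x) < e" if "\<bar>t - x\<bar> < d'" for t
  proof -
    have t: "s \<le> t" "t \<le> b" "t - s \<le> x - s + e / (6 * C)" using that d' by linarith+
    have "C * (t - s) \<le> C * (x - s + e / (6 * C))"
      using t(3) C by (intro mult_left_mono) auto
    also have "\<dots> = C * (x - s) + e / 6" using C by (simp add: field_simps)
    finally have "norm (F t - T t s (F s)) \<le> e / 3"
      using F[of s t] s t by simp
    moreover have "norm (F x - T x s (F s)) \<le> e / 6"
      using F[of s x] s x by simp
    moreover have "norm (T t s (F s) - T x s (F s)) < e / 3" using d(2) that d' by simp
    moreover have "norm (F t - F x) \<le>
        norm (F t - T t s (F s)) + norm (T t s (F s) - T x s (F s)) + norm (F x - T x s (F s))"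
      by (rule order_trans[OF _ order_trans[OF norm_triangle_ineq4 add_right_mono[OF norm_triangle_ineq]]])
        simp
    ultimately show ?thesis using \<open>e > 0\<close> by linarith
  qed
  then show "\<exists>d>0. \<forall>t. dist t x < d \<longrightarrow> dist (F t) (F x) < e"
    using d'(1) by (auto simp: dist_norm)
qed

lemma evolution_integrable:
  fixes T :: "real \<Rightarrow> real \<Rightarrow> ('a::banach \<Rightarrow>\<^sub>L 'a)"
  assumes "evolution_family T" and "continuous_on {a..c} h"
  shows "(\<lambda>\<tau>. T c \<tau> (h \<tau>)) integrable_on {a..c}"
proof (rule integrable_continuous_interval, rule compact_strongly_continuous_apply)
  show "continuous_on {a..c} (\<lambda>\<tau>. T c \<tau> x)" for x
    by (rule continuous_on_subset[OF evolution_familyD(4)[OF assms(1)]]) auto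
qed (use assms in auto)

text \<open>Three rates occur: \<open>3 * \<gamma>\<close> for \<open>G\<close>,
  \<open>2 * \<gamma>\<close> for the kernel with small integral, and the difference
  \<open>\<gamma>\<close> for the weight. The contraction constant is
  \<open>\<theta>\<close>.\<close>

locale green_perturbation =
  fixes T U G :: "real \<Rightarrow> real \<Rightarrow> ('a::banach \<Rightarrow>\<^sub>L 'a)" and B :: "real \<Rightarrow> ('a \<Rightarrow>\<^sub>L 'a)"
    and K \<gamma> \<epsilon> \<theta> :: real
  assumes T_evolution: "evolution_family T" and U_evolution: "evolution_family U"
    and B_continuous: "continuous_on UNIV B"
    and U_eq: "\<And>t s x. s \<le> t \<Longrightarrow>
      U t s x = T t s x + integral {s..t} (\<lambda>\<tau>. T t \<tau> (B \<tau> (U \<tau> s x)))"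
    and green: "green_function T G" and bound: "green_bound G K (3 * \<gamma>) \<epsilon>"
    and K_pos: "K > 0" and \<gamma>_pos: "\<gamma> > 0" and \<theta>_less: "\<theta> < 1"
    and kernel_integrable:
      "\<And>t. (\<lambda>\<tau>. exp (- (2 * \<gamma>) * \<bar>t - \<tau>\<bar>) * (norm (B \<tau>) * exp (\<epsilon> * \<bar>\<tau>\<bar>))) integrable_on UNIV"
    and kernel_le:
      "\<And>t. K * integral UNIV (\<lambda>\<tau>. exp (- (2 * \<gamma>) * \<bar>t - \<tau>\<bar>) * (norm (B \<tau>) * exp (\<epsilon> * \<bar>\<tau>\<bar>))) \<le> \<theta>"
begin

section \<open>Estimates for the Green integral operator\<close>

lemmas T = evolution_familyD[OF T_evolution]
lemmas U = evolution_familyD[OF U_evolution]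
lemmas G = green_functionD[OF green]

lemma G_le: "norm (G t s) \<le> K * (exp (- (3 * \<gamma>) * \<bar>t - s\<bar>) * exp (\<epsilon> * \<bar>s\<bar>))"
  and id_minus_G_le: "norm (id_blinfun - G s s) \<le> K * exp (\<epsilon> * \<bar>s\<bar>)"
  using bound unfolding green_bound_def exp_add[symmetric] by blast+

definition kernel :: "real \<Rightarrow> real \<Rightarrow> real" where
  "kernel t \<tau> = exp (- (2 * \<gamma>) * \<bar>t - \<tau>\<bar>) * (norm (B \<tau>) * exp (\<epsilon> * \<bar>\<tau>\<bar>))"

definition green_integral :: "(real \<Rightarrow> 'a) \<Rightarrow> real \<Rightarrow> 'a" where
  "green_integral f t = integral UNIV (\<lambda>\<tau>. G t \<tau> (B \<tau> (f \<tau>)))"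

text \<open>
  Bochner integrals require second countable spaces, so all integrals are gauge integrals, and the
  integrability of the integrand on compact intervals is made part of the function class.
\<close>

definition admissible :: "(real \<Rightarrow> 'a) \<Rightarrow> bool" where
  "admissible f \<longleftrightarrow> bounded (range f) \<and>
     (\<forall>t a b. (\<lambda>\<tau>. G t \<tau> (B \<tau> (f \<tau>))) integrable_on {a..b})"

lemma kernel_nonneg: "kernel t \<tau> \<ge> 0"
  by (simp add: kernel_def)

lemma kernel: "kernel t integrable_on UNIV" "K * integral UNIV (kernel t) \<le> \<theta>"
  using kernel_integrable[of t] kernel_le[of t] unfolding kernel_def[abs_def] by auto

lemma \<theta>_nonneg: "\<theta> \<ge> 0"
  using kernel[of 0] K_pos integral_nonneg[OF kernel(1) kernel_nonneg]
  by (meson mult_nonneg_nonneg order_trans less_imp_le)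

text \<open>By the triangle inequality, moving the weight from \<open>\<tau>\<close> to
  \<open>t\<close> costs \<open>exp (l * \<bar>t - \<tau>\<bar>)\<close>; since
  \<open>l \<le> \<gamma>\<close>, this is paid by lowering the rate of \<open>G\<close> from
  \<open>3 * \<gamma>\<close> to \<open>2 * \<gamma>\<close>.\<close>

lemma green_integrand_le:
  assumes l: "0 \<le> l" "l \<le> \<gamma>" and C: "norm (f \<tau>) \<le> C * exp (- l * \<bar>\<tau> - s\<bar>)"
  shows "norm (G t \<tau> (B \<tau> (f \<tau>))) \<le> (K * C * exp (- l * \<bar>t - s\<bar>)) * kernel t \<tau>"
proof -
  have C0: "C \<ge> 0"
    using C by (meson exp_gt_zero norm_ge_zero order_trans zero_le_mult_iff not_le)
  have "l * \<bar>t - s\<bar> \<le> l * \<bar>t - \<tau>\<bar> + l * \<bar>\<tau> - s\<bar>"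
    using l(1) by (simp add: distrib_left[symmetric] mult_left_mono)
  moreover have "l * \<bar>t - \<tau>\<bar> \<le> \<gamma> * \<bar>t - \<tau>\<bar>" using l by (intro mult_right_mono) auto
  ultimately have exps: "exp (- (3 * \<gamma>) * \<bar>t - \<tau>\<bar>) * exp (- l * \<bar>\<tau> - s\<bar>) \<le>
      exp (- (2 * \<gamma>) * \<bar>t - \<tau>\<bar>) * exp (- l * \<bar>t - s\<bar>)"
    unfolding exp_add[symmetric] by (simp add: algebra_simps)
  have "norm (G t \<tau> (B \<tau> (f \<tau>))) \<le> norm (G t \<tau>) * (norm (B \<tau>) * norm (f \<tau>))"
    by (meson mult_left_mono norm_blinfun norm_ge_zero order_trans)
  also have "\<dots> \<le> (K * (exp (- (3 * \<gamma>) * \<bar>t - \<tau>\<bar>) * exp (\<epsilon> * \<bar>\<tau>\<bar>))) * (norm (B \<tau>) * (C * exp (- l * \<bar>\<tau> - s\<bar>)))"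
    using K_pos by (intro mult_mono G_le mult_left_mono C) auto
  also have "\<dots> = (K * C * norm (B \<tau>) * exp (\<epsilon> * \<bar>\<tau>\<bar>)) * (exp (- (3 * \<gamma>) * \<bar>t - \<tau>\<bar>) * exp (- l * \<bar>\<tau> - s\<bar>))"
    by (simp only: mult_ac)
  also have "\<dots> \<le> (K * C * norm (B \<tau>) * exp (\<epsilon> * \<bar>\<tau>\<bar>)) * (exp (- (2 * \<gamma>) * \<bar>t - \<tau>\<bar>) * exp (- l * \<bar>t - s\<bar>))"
    using K_pos C0 by (intro mult_left_mono exps) auto
  also have "\<dots> = (K * C * exp (- l * \<bar>t - s\<bar>)) * kernel t \<tau>"
    by (simp add: kernel_def mult_ac)
  finally show ?thesis .
qed

lemma admissible_bounded:
  assumes "admissible f" obtains C where "C > 0" "\<And>t. norm (f t) \<le> C"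
  using assms unfolding admissible_def bounded_pos by auto

lemma admissible_integrable:
  assumes "admissible f"
  shows "(\<lambda>\<tau>. G t \<tau> (B \<tau> (f \<tau>))) integrable_on UNIV"
proof -
  obtain C where C: "\<And>t. norm (f t) \<le> C" using admissible_bounded[OF assms] by blast
  show ?thesis
  proof (rule integrable_on_UNIV_dominated)
    show "(\<lambda>\<tau>. (K * C) * kernel t \<tau>) integrable_on UNIV"
      using integrable_on_cmult_left[OF kernel(1)[of t], of "K * C"] by simp
    show "norm (G t \<tau> (B \<tau> (f \<tau>))) \<le> K * C * kernel t \<tau>" for \<tau>
      using green_integrand_le[of 0 f \<tau> C 0 t] C \<gamma>_pos by simp
  qed (use assms in \<open>auto simp: admissible_def\<close>)
qed

text \<open>Used with \<open>l = 0\<close> for contraction and uniqueness in the sup norm, and with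
  \<open>l = \<gamma>\<close> for preserving decay away from \<open>s\<close>, with the same factor
  \<open>\<theta>\<close>.\<close>

lemma green_integral_le:
  assumes f: "admissible f" and l: "0 \<le> l" "l \<le> \<gamma>"
    and C: "\<And>\<tau>. norm (f \<tau>) \<le> C * exp (- l * \<bar>\<tau> - s\<bar>)"
  shows "norm (green_integral f t) \<le> \<theta> * C * exp (- l * \<bar>t - s\<bar>)"
proof -
  have C0: "C \<ge> 0"
    using C[of s] by (simp add: order_trans[OF norm_ge_zero])
  have "norm (green_integral f t) \<le> integral UNIV (\<lambda>\<tau>. (K * C * exp (- l * \<bar>t - s\<bar>)) * kernel t \<tau>)"
    unfolding green_integral_def
  proof (rule integral_norm_bound_integral[OF admissible_integrable[OF f]])
    show "(\<lambda>\<tau>. (K * C * exp (- l * \<bar>t - s\<bar>)) * kernel t \<tau>) integrable_on UNIV"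
      using integrable_on_cmult_left[OF kernel(1)[of t], of "K * C * exp (- l * \<bar>t - s\<bar>)"] by simp
  qed (rule green_integrand_le[OF l C])
  also have "\<dots> = (K * integral UNIV (kernel t)) * (C * exp (- l * \<bar>t - s\<bar>))"
    by (simp add: mult_ac)
  also have "\<dots> \<le> \<theta> * (C * exp (- l * \<bar>t - s\<bar>))"
    using kernel(2) C0 by (intro mult_right_mono) auto
  finally show ?thesis by (simp add: mult_ac)
qed

text \<open>Gauge integrability survives the cut because the half-line meets \<open>{a..b}\<close>
  in an interval.\<close>

lemma admissible_cut:
  assumes "admissible f"
  shows "admissible (\<lambda>\<tau>. of_bool (\<tau> < s) *\<^sub>R f \<tau>)"
  unfolding admissible_def
proof (intro conjI allI)
  show "bounded (range (\<lambda>\<tau>. of_bool (\<tau> < s) *\<^sub>R f \<tau>))"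
  proof -
    obtain C where "C > 0" "\<And>t. norm (f t) \<le> C" using admissible_bounded[OF assms] by blast
    then show ?thesis by (auto simp: bounded_iff of_bool_def intro!: exI[of _ C])
  qed
  fix t a b
  have "(\<lambda>\<tau>. G t \<tau> (B \<tau> (f \<tau>))) integrable_on ({..s} \<inter> {a..b})"
    using assms by (simp add: admissible_def)
  then have "(\<lambda>\<tau>. if \<tau> \<in> {..s} then G t \<tau> (B \<tau> (f \<tau>)) else 0) integrable_on {a..b}"
    by (simp only: integrable_restrict_Int)
  \<comment> \<open>The cut is strict while the half-line \<open>{..s}\<close> is closed; they
    differ only at \<open>s\<close>.\<close>
  then show "(\<lambda>\<tau>. G t \<tau> (B \<tau> (of_bool (\<tau> < s) *\<^sub>R f \<tau>))) integrable_on {a..b}"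
    by (rule integrable_spike_finite[of "{s}", rotated 2]) (auto simp: blinfun.scaleR_right)
qed

lemma admissible_add:
  assumes "admissible f" "admissible g"
  shows "admissible (\<lambda>\<tau>. f \<tau> + g \<tau>)"
  using assms unfolding admissible_def
  by (auto simp: blinfun.add_right intro!: integrable_add bounded_plus_comp)

lemma admissible_scaleR:
  assumes "admissible f"
  shows "admissible (\<lambda>\<tau>. c *\<^sub>R f \<tau>)"
  using assms unfolding admissible_def
  by (auto simp: blinfun.scaleR_right intro!: integrable_cmul bounded_scaleR_comp)

lemma admissible_diff:
  assumes "admissible f" "admissible g"
  shows "admissible (\<lambda>\<tau>. f \<tau> - g \<tau>)"
  using admissible_add[OF assms(1) admissible_scaleR[OF assms(2), of "-1"]] by simp

lemma green_integral_add:
  assumes "admissible f" "admissible g"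
  shows "green_integral (\<lambda>\<tau>. f \<tau> + g \<tau>) t = green_integral f t + green_integral g t"
  unfolding green_integral_def
  by (simp add: blinfun.add_right integral_add admissible_integrable assms)

lemma green_integral_scaleR:
  shows "green_integral (\<lambda>\<tau>. c *\<^sub>R f \<tau>) t = c *\<^sub>R green_integral f t"
  unfolding green_integral_def by (simp add: blinfun.scaleR_right)

lemma green_integral_diff:
  assumes "admissible f" "admissible g"
  shows "green_integral (\<lambda>\<tau>. f \<tau> - g \<tau>) t = green_integral f t - green_integral g t"
  unfolding green_integral_def
  by (simp add: blinfun.diff_right integral_diff admissible_integrable assms)

text \<open>The third Green identity writes \<open>G t \<tau>\<close> as \<open>G t c\<close> after
  \<open>T c \<tau>\<close>, plus \<open>T t \<tau>\<close> when \<open>\<tau> \<le> t\<close>. Thus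
  regularity in \<open>\<tau>\<close> reduces to that of \<open>T\<close> with a fixed final
  time.\<close>

lemma admissible_continuous:
  assumes f: "continuous_on UNIV f" and bdd: "\<And>t. norm (f t) \<le> C"
  shows "admissible f"
  unfolding admissible_def
proof (intro conjI allI)
  show "bounded (range f)" using bdd by (auto simp: bounded_iff)
  fix t a b :: real
  \<comment> \<open>Strictly beyond \<open>t\<close>, so that the extra term of the identity is
    present for every \<open>\<tau> \<le> t\<close>.\<close>
  define c where "c = max b (t + 1)"
  have c: "t < c" "b \<le> c" by (auto simp: c_def)
  have cont: "continuous_on S (\<lambda>\<tau>. B \<tau> (f \<tau>))" for S
    using f B_continuous by (intro continuous_intros) (auto intro: continuous_on_subset)
  have "(\<lambda>\<tau>. T t \<tau> (B \<tau> (f \<tau>))) integrable_on ({..t} \<inter> {a..c})"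
    using evolution_integrable[OF T_evolution cont, where a = a and c = t] c by (simp add: min_def)
  then have "(\<lambda>\<tau>. if \<tau> \<in> {..t} then T t \<tau> (B \<tau> (f \<tau>)) else 0) integrable_on {a..c}"
    by (simp only: integrable_restrict_Int)
  with integral_apply_blinfun(1)[OF evolution_integrable[OF T_evolution cont, where a = a and c = c], of "G t c"]
  have "(\<lambda>\<tau>. G t c (T c \<tau> (B \<tau> (f \<tau>))) + (if \<tau> \<in> {..t} then T t \<tau> (B \<tau> (f \<tau>)) else 0)) integrable_on {a..c}"
    by (rule integrable_add)
  then have "(\<lambda>\<tau>. G t \<tau> (B \<tau> (f \<tau>))) integrable_on {a..c}"
    by (rule integrable_eq) (use c in \<open>auto simp: G(3)\<close>)
  then show "(\<lambda>\<tau>. G t \<tau> (B \<tau> (f \<tau>))) integrable_on {a..b}"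
    by (rule integrable_on_subinterval) (use c in auto)
qed

lemma G_apply_le: "norm (G t s x) \<le> (K * exp (\<epsilon> * \<bar>s\<bar>) * norm x) * exp (- \<gamma> * \<bar>t - s\<bar>)"
  and id_minus_G_apply_le: "norm (x - G s s x) \<le> K * exp (\<epsilon> * \<bar>s\<bar>) * norm x"
proof -
  have "norm (G t s) \<le> K * (exp (- \<gamma> * \<bar>t - s\<bar>) * exp (\<epsilon> * \<bar>s\<bar>))"
    using G_le[of t s] K_pos \<gamma>_pos
    by (elim order_trans) (simp add: mult_right_mono)
  then have "norm (G t s x) \<le> K * (exp (- \<gamma> * \<bar>t - s\<bar>) * exp (\<epsilon> * \<bar>s\<bar>)) * norm x"
    by (meson mult_right_mono norm_blinfun norm_ge_zero order_trans)
  then show "norm (G t s x) \<le> (K * exp (\<epsilon> * \<bar>s\<bar>) * norm x) * exp (- \<gamma> * \<bar>t - s\<bar>)"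
    by (simp only: mult_ac)
  have "norm ((id_blinfun - G s s) x) \<le> K * exp (\<epsilon> * \<bar>s\<bar>) * norm x"
    by (meson id_minus_G_le mult_right_mono norm_blinfun norm_ge_zero order_trans)
  then show "norm (x - G s s x) \<le> K * exp (\<epsilon> * \<bar>s\<bar>) * norm x"
    by (simp add: blinfun.diff_left)
qed

lemma G_apply_bounded: "norm (G t s x) \<le> K * exp (\<epsilon> * \<bar>s\<bar>) * norm x"
proof -
  have "exp (- \<gamma> * \<bar>t - s\<bar>) \<le> 1" using \<gamma>_pos by simp
  then have "(K * exp (\<epsilon> * \<bar>s\<bar>) * norm x) * exp (- \<gamma> * \<bar>t - s\<bar>) \<le> (K * exp (\<epsilon> * \<bar>s\<bar>) * norm x) * 1"
    using K_pos by (intro mult_left_mono) auto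
  then show ?thesis using G_apply_le[of t s x] by simp
qed

text \<open>The jump at \<open>s\<close> is handled by gluing two continuous functions:
  \<open>?p\<close> extends the part from \<open>s\<close> on by a constant to the left, and
  \<open>?m\<close> extends the part before \<open>s\<close> by its left limit
  \<open>G s s x - x\<close>.\<close>

lemma admissible_green: "admissible (\<lambda>t. G t s x)"
proof -
  let ?p = "\<lambda>t. G (max t s) s x" and ?m = "\<lambda>t. if t < s then G t s x else G s s x - x"
  let ?C = "K * exp (\<epsilon> * \<bar>s\<bar>) * norm x"
  have "?p t = T (max t s) s (G s s x)" for t
    using G(1)[of s "max t s" s x] by simp
  moreover have "continuous_on UNIV (\<lambda>t. T (max t s) s (G s s x))"
    by (rule continuous_on_compose2[OF T(3)[of s "G s s x"]]) (auto intro!: continuous_intros)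
  ultimately have "continuous_on UNIV ?p" by simp
  then have p: "admissible ?p"
    by (rule admissible_continuous) (rule G_apply_bounded)
  have "isCont ?m t" for t
  proof -
    \<comment> \<open>From a start before both \<open>t\<close> and \<open>s\<close>,
      \<open>?m\<close> is an orbit of \<open>T\<close> stopped at time \<open>s\<close>.\<close>
    define a where "a = min t s - 1"
    have m: "?m \<tau> = T (min \<tau> s) a (G a s x)" if "a \<le> \<tau>" for \<tau>
      using that G(1)[of a \<tau> s x] G(1)[of a s s x] by (auto simp: a_def T(1) min_def)
    have "continuous_on {a..} (\<lambda>\<tau>. T (min \<tau> s) a (G a s x))"
      by (rule continuous_on_compose2[OF T(3)[of a "G a s x"]])
        (auto intro!: continuous_intros simp: a_def)
    then have "continuous_on {a..} ?m"
      using m by (subst continuous_on_cong[OF refl]) auto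
    then show ?thesis
      by (rule continuous_on_interior) (simp add: a_def)
  qed
  then have "continuous_on UNIV ?m" by (simp add: continuous_on_eq_continuous_at)
  then have m: "admissible ?m"
    by (rule admissible_continuous[of _ ?C])
      (use G_apply_bounded id_minus_G_apply_le in \<open>auto simp: norm_minus_commute\<close>)
  have "admissible (\<lambda>t. of_bool (t < s) *\<^sub>R ?m t + (?p t - of_bool (t < s) *\<^sub>R ?p t))"
    by (intro admissible_add admissible_diff admissible_cut p m)
  also have "(\<lambda>t. of_bool (t < s) *\<^sub>R ?m t + (?p t - of_bool (t < s) *\<^sub>R ?p t)) = (\<lambda>t. G t s x)"
    by (auto simp: max_def)
  finally show ?thesis .
qed

text \<open>Separate strong continuity gives no bound in both times at once. For
  \<open>a < s\<close> the first Green identity expresses \<open>T t s\<close> through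
  \<open>G t s\<close>, \<open>G a s\<close> and \<open>T t a\<close>, and only the last needs a
  compactness argument, in one variable.\<close>

lemma T_bounded:
  obtains C where "C > 0" "\<And>s t. a \<le> s \<Longrightarrow> s \<le> t \<Longrightarrow> t \<le> b \<Longrightarrow> norm (T t s) \<le> C"
proof -
  obtain D where D: "D > 0" "\<And>t. t \<in> {a..b} \<Longrightarrow> norm (T t a) \<le> D"
  proof (rule compact_strongly_continuous_bounded[of "{a..b}" "\<lambda>t. T t a"])
    show "continuous_on {a..b} (\<lambda>t. T t a x)" for x
      by (rule continuous_on_subset[OF T(3)]) auto
  qed (use that in auto)
  \<comment> \<open>The absolute value of \<open>\<epsilon>\<close> makes the bound valid for either
    sign of \<open>\<epsilon>\<close>.\<close>
  define E where "E = K * exp (\<bar>\<epsilon>\<bar> * max \<bar>a\<bar> \<bar>b\<bar>)"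
  have E: "E > 0" using K_pos by (simp add: E_def)
  have GE: "norm (G t s) \<le> E" if "a \<le> s" "s \<le> b" for t s
  proof -
    have "\<epsilon> * \<bar>s\<bar> \<le> \<bar>\<epsilon>\<bar> * max \<bar>a\<bar> \<bar>b\<bar>"
      using that by (intro mult_mono) auto
    then have "- (3 * \<gamma>) * \<bar>t - s\<bar> + \<epsilon> * \<bar>s\<bar> \<le> \<bar>\<epsilon>\<bar> * max \<bar>a\<bar> \<bar>b\<bar>"
      using \<gamma>_pos by (smt (verit) mult_minus_left mult_nonneg_nonneg abs_ge_zero)
    then show ?thesis
      using G_le[of t s] K_pos unfolding E_def exp_add[symmetric] by (elim order_trans) simp
  qed
  have "norm (T t s) \<le> D + (E + D * E)" if st: "a \<le> s" "s \<le> t" "t \<le> b" for s t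
  proof (cases "s = a")
    case True
    then show ?thesis using D(2)[of t] st E D(1) by (smt (verit) atLeastAtMost_iff mult_pos_pos)
  next
    case False
    have "T t s = G t s - (T t a o\<^sub>L G a s)"
      using G(1)[of a t s] st False by (intro blinfun_eqI) (simp add: blinfun.diff_left)
    then have "norm (T t s) \<le> norm (G t s) + norm (T t a o\<^sub>L G a s)"
      by (simp add: norm_triangle_ineq4)
    also have "\<dots> \<le> E + D * E"
      using st D GE by (intro add_mono order_trans[OF norm_blinfun_compose] mult_mono) auto
    finally show ?thesis using D(1) by simp
  qed
  then show ?thesis using that[of "D + (E + D * E)"] D E by (simp add: add_pos_pos)
qed

lemma B_bounded:
  obtains C where "C > 0" "\<And>t. a \<le> t \<Longrightarrow> t \<le> b \<Longrightarrow> norm (B t) \<le> C"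
proof -
  have "bounded (B ` {a..b})"
    by (intro compact_imp_bounded compact_continuous_image continuous_on_subset[OF B_continuous]) auto
  then show ?thesis using that by (auto simp: bounded_pos)
qed

text \<open>Under the integral, the first Green identity leaves of \<open>G t \<tau>\<close> minus
  \<open>T t r\<close> after \<open>G r \<tau>\<close> exactly \<open>T t \<tau>\<close> for
  \<open>r < \<tau> \<le> t\<close>. The Green integral is therefore a mild solution with forcing
  \<open>B f\<close>.\<close>

lemma green_integral_evolution:
  assumes f: "admissible f" and rt: "r \<le> t"
  shows "(\<lambda>\<tau>. T t \<tau> (B \<tau> (f \<tau>))) integrable_on {r..t}"
    and "green_integral f t = T t r (green_integral f r) + integral {r..t} (\<lambda>\<tau>. T t \<tau> (B \<tau> (f \<tau>)))"
proof -
  let ?I = "\<lambda>t \<tau>. G t \<tau> (B \<tau> (f \<tau>))" and ?h = "\<lambda>\<tau>. T t \<tau> (B \<tau> (f \<tau>))"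
  have int: "?I t integrable_on UNIV" "(\<lambda>\<tau>. T t r (?I r \<tau>)) integrable_on UNIV"
    using admissible_integrable[OF f] integral_apply_blinfun(1)[OF admissible_integrable[OF f]] by auto
  have "((\<lambda>\<tau>. ?I t \<tau> - T t r (?I r \<tau>)) has_integral (green_integral f t - T t r (green_integral f r))) UNIV"
    using has_integral_diff[OF integrable_integral[OF int(1)] integrable_integral[OF int(2)]]
    by (simp add: green_integral_def integral_apply_blinfun(2)[OF admissible_integrable[OF f]])
  then have "((\<lambda>\<tau>. if \<tau> \<in> {r..t} then ?h \<tau> else 0) has_integral
      (green_integral f t - T t r (green_integral f r))) UNIV"
    by (rule has_integral_spike_finite[of "{r}", rotated 2]) (use rt in \<open>auto simp: G(1)[OF rt]\<close>)
  then have "(?h has_integral (green_integral f t - T t r (green_integral f r))) {r..t}"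
    by (simp only: has_integral_restrict_UNIV)
  then show "?h integrable_on {r..t}"
    and "green_integral f t = T t r (green_integral f r) + integral {r..t} ?h"
    by (auto simp: has_integral_iff)
qed

text \<open>The mild formula shows that the integral follows \<open>T\<close> up to an error
  proportional to the elapsed time, even if \<open>f\<close> jumps.\<close>

lemma green_integral_continuous:
  assumes f: "admissible f"
  shows "continuous_on UNIV (green_integral f)"
proof -
  have "isCont (green_integral f) x" for x
  proof -
    obtain C where C: "C > 0" "\<And>t. norm (f t) \<le> C" using admissible_bounded[OF f] by blast
    obtain D where D: "D > 0" "\<And>s t. x - 1 \<le> s \<Longrightarrow> s \<le> t \<Longrightarrow> t \<le> x + 1 \<Longrightarrow> norm (T t s) \<le> D"
      using T_bounded[of "x - 1" "x + 1"] by blast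
    obtain E where E: "E > 0" "\<And>t. x - 1 \<le> t \<Longrightarrow> t \<le> x + 1 \<Longrightarrow> norm (B t) \<le> E"
      using B_bounded[of "x - 1" "x + 1"] by blast
    show ?thesis
    proof (rule approximate_evolution_continuous[OF T_evolution, of "x - 1" x "x + 1" "D * (E * C)"])
      fix s t assume st: "x - 1 \<le> s" "s \<le> t" "t \<le> x + 1"
      have "norm (T t \<tau> (B \<tau> (f \<tau>))) \<le> D * (E * C)" if "\<tau> \<in> {s..t}" for \<tau>
        using st that D E C
        by (intro order_trans[OF norm_blinfun] mult_mono) auto
      then have "norm (integral {s..t} (\<lambda>\<tau>. T t \<tau> (B \<tau> (f \<tau>)))) \<le> integral {s..t} (\<lambda>_. D * (E * C))"
        by (intro integral_norm_bound_integral green_integral_evolution(1)[OF f st(2)]) auto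
      then show "norm (green_integral f t - T t s (green_integral f s)) \<le> D * (E * C) * (t - s)"
        using green_integral_evolution(2)[OF f st(2)] st by (simp add: mult_ac)
    qed (use C D E in auto)
  qed
  then show ?thesis by (simp add: continuous_on_eq_continuous_at)
qed

text \<open>An admissible \<open>f\<close> may be discontinuous, hence the sup bound is iterated
  directly and decays like \<open>\<theta> ^ n\<close>.\<close>

lemma green_fixed_point_zero:
  assumes f: "admissible f" and eq: "\<And>t. f t = green_integral f t"
  shows "f t = 0"
proof -
  obtain C where C: "C > 0" "\<And>t. norm (f t) \<le> C" using admissible_bounded[OF f] by blast
  have "norm (f t) \<le> \<theta> ^ n * C" for n t
  proof (induction n arbitrary: t)
    case (Suc n)
    have "norm (green_integral f t) \<le> \<theta> * (\<theta> ^ n * C) * exp (- 0 * \<bar>t - 0\<bar>)"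
      by (rule green_integral_le[OF f]) (use Suc \<gamma>_pos in auto)
    then show ?case by (simp add: eq[symmetric] mult_ac)
  qed (use C in simp)
  moreover have "(\<lambda>n. \<theta> ^ n * C) \<longlonglongrightarrow> 0 * C"
    using \<theta>_nonneg \<theta>_less by (intro tendsto_intros LIMSEQ_realpow_zero)
  ultimately have "norm (f t) \<le> 0 * C"
    by (intro LIMSEQ_le_const) auto
  then show ?thesis by simp
qed

section \<open>Solving the perturbed Green equation\<close>

definition green_solution :: "real \<Rightarrow> 'a \<Rightarrow> (real \<Rightarrow> 'a) \<Rightarrow> bool" where
  "green_solution s x f \<longleftrightarrow> admissible f \<and> (\<forall>t. f t = G t s x + green_integral f t)"

lemma green_solution_unique:
  assumes f: "green_solution s x f" and g: "green_solution s x g"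
  shows "f t = g t"
proof -
  have fg: "admissible f" "admissible g" using f g by (auto simp: green_solution_def)
  have "f t - g t = green_integral (\<lambda>\<tau>. f \<tau> - g \<tau>) t" for t
    unfolding green_integral_diff[OF fg] using f g by (simp add: green_solution_def)
  then have "f t - g t = 0"
    using green_fixed_point_zero[OF admissible_diff[OF fg]] by blast
  then show ?thesis by simp
qed

text \<open>A solution jumps at \<open>s\<close>, but its integral part does not; so the unknown is
  the bounded continuous function \<open>v\<close> with \<open>f t = G t s x + v t\<close>. Decay is
  built into the closed set \<open>S\<close>, which is invariant by the weighted estimate, while the
  contraction is measured in the plain sup metric.\<close>

lemma green_solution_exists:
  obtains f where "green_solution s x f"
    and "\<And>t. norm (green_integral f t) \<le> \<theta> * (K * exp (\<epsilon> * \<bar>s\<bar>) * norm x / (1 - \<theta>)) * exp (- \<gamma> * \<bar>t - s\<bar>)"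
proof -
  define A where "A = K * exp (\<epsilon> * \<bar>s\<bar>) * norm x"
  \<comment> \<open>The solution of \<open>\<theta> * (A + C) = C\<close>, which is what invariance
    of \<open>S\<close> asks for.\<close>
  define C where "C = \<theta> * (A / (1 - \<theta>))"
  define S where "S = {v :: real \<Rightarrow>\<^sub>C 'a. \<forall>t. norm (v t) \<le> C * exp (- \<gamma> * \<bar>t - s\<bar>)}"
  define \<Phi> where "\<Phi> v = Bcontfun (green_integral (\<lambda>t. G t s x + apply_bcontfun v t))" for v :: "real \<Rightarrow>\<^sub>C 'a"
  have A: "A \<ge> 0" and C: "C \<ge> 0" "\<theta> * (A + C) = C"
    using K_pos \<theta>_nonneg \<theta>_less by (auto simp: A_def C_def field_simps)
  have adm: "admissible (apply_bcontfun v)" for v :: "real \<Rightarrow>\<^sub>C 'a"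
  proof -
    obtain D where "\<And>t. norm (v t) \<le> D"
      using bounded_apply_bcontfun[of v] by (auto simp: bounded_iff)
    then show ?thesis by (intro admissible_continuous) auto
  qed
  have adm': "admissible (\<lambda>t. G t s x + apply_bcontfun v t)" for v :: "real \<Rightarrow>\<^sub>C 'a"
    by (intro admissible_add admissible_green adm)
  have le: "norm (green_integral (\<lambda>t. G t s x + apply_bcontfun v t) t) \<le> C * exp (- \<gamma> * \<bar>t - s\<bar>)"
    if "v \<in> S" for v t
  proof -
    have "norm (G \<tau> s x + v \<tau>) \<le> (A + C) * exp (- \<gamma> * \<bar>\<tau> - s\<bar>)" for \<tau>
    proof -
      have "norm (v \<tau>) \<le> C * exp (- \<gamma> * \<bar>\<tau> - s\<bar>)" using that by (auto simp: S_def)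
      then show ?thesis
        using norm_triangle_mono[OF G_apply_le[of \<tau> s x]] by (simp add: A_def distrib_right)
    qed
    from green_integral_le[OF adm' _ _ this, of t] show ?thesis
      using \<gamma>_pos C(2) by (simp add: mult.assoc[symmetric])
  qed
  have \<Phi>: "apply_bcontfun (\<Phi> v) = green_integral (\<lambda>t. G t s x + apply_bcontfun v t)" if "v \<in> S" for v
  proof -
    have "norm (green_integral (\<lambda>t. G t s x + apply_bcontfun v t) t) \<le> C" for t
    proof -
      have "C * exp (- \<gamma> * \<bar>t - s\<bar>) \<le> C * 1" using C \<gamma>_pos by (intro mult_left_mono) auto
      then show ?thesis using le[OF that, of t] by simp
    qed
    then have "green_integral (\<lambda>t. G t s x + apply_bcontfun v t) \<in> bcontfun"
      unfolding bcontfun_def using green_integral_continuous[OF adm'] by (auto simp: bounded_iff)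
    then show ?thesis unfolding \<Phi>_def by (rule Bcontfun_inverse)
  qed
  have "\<exists>!v\<in>S. \<Phi> v = v"
  proof (rule Banach_fix)
    have "S = PiC UNIV (\<lambda>t. cball 0 (C * exp (- \<gamma> * \<bar>t - s\<bar>)))"
      by (auto simp: S_def mem_PiC_iff Pi_iff)
    then have "closed S" by (simp add: closed_PiC)
    then show "complete S" by (simp add: complete_eq_closed)
    have "const_bcontfun 0 \<in> S" using C by (simp add: S_def const_bcontfun.rep_eq)
    then show "S \<noteq> {}" by blast
    show "\<Phi> ` S \<subseteq> S" using \<Phi> le by (auto simp: S_def)
    fix v w assume vw: "v \<in> S" "w \<in> S"
    show "dist (\<Phi> v) (\<Phi> w) \<le> \<theta> * dist v w"
    proof (rule dist_bound)
      fix t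
      have "dist (\<Phi> v t) (\<Phi> w t) = norm (green_integral (\<lambda>\<tau>. v \<tau> - w \<tau>) t)"
        using green_integral_diff[OF adm' adm', of v w t] vw by (simp add: \<Phi> dist_norm)
      also have "\<dots> \<le> \<theta> * dist v w * exp (- 0 * \<bar>t - s\<bar>)"
        by (rule green_integral_le[OF admissible_diff[OF adm adm]])
          (use \<gamma>_pos dist_bounded[of v _ w] in \<open>auto simp: dist_norm\<close>)
      finally show "dist (\<Phi> v t) (\<Phi> w t) \<le> \<theta> * dist v w" by simp
    qed
  qed (use \<theta>_nonneg \<theta>_less in auto)
  then obtain v where v: "v \<in> S" "\<Phi> v = v" by blast
  define f where "f t = G t s x + v t" for t
  have fv: "green_integral f = v"
    using \<Phi>[OF v(1)] v(2) by (simp add: f_def[abs_def])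
  have "green_solution s x f"
    unfolding green_solution_def fv using adm'[of v] by (auto simp: f_def[abs_def])
  moreover have "norm (green_integral f t) \<le> C * exp (- \<gamma> * \<bar>t - s\<bar>)" for t
    unfolding fv using v(1) by (simp add: S_def)
  ultimately show ?thesis using that by (simp add: C_def A_def)
qed

text \<open>The choice is harmless because solutions are unique; uniqueness also yields the
  linearity in \<open>x\<close> that gives \<open>Blinfun\<close> its meaning.\<close>

definition perturbed_green :: "real \<Rightarrow> real \<Rightarrow> 'a \<Rightarrow>\<^sub>L 'a" where
  "perturbed_green t s = Blinfun (\<lambda>x. (SOME f. green_solution s x f) t)"

text \<open>Sums and multiples of solutions solve the equation for the corresponding initial value.
  Both bounds sum the geometric series of \<open>\<theta>\<close>; the diagonal one starts from
  \<open>id_blinfun - G s s\<close> instead of \<open>G s s\<close>.\<close>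

lemma perturbed_green_solution: "green_solution s x (\<lambda>t. perturbed_green t s x)"
  and perturbed_green_le:
    "norm (perturbed_green t s x) \<le> K / (1 - \<theta>) * exp (- \<gamma> * \<bar>t - s\<bar> + \<epsilon> * \<bar>s\<bar>) * norm x"
  and id_minus_perturbed_green_le:
    "norm (x - perturbed_green s s x) \<le> K / (1 - \<theta>) * exp (\<epsilon> * \<bar>s\<bar>) * norm x"
proof -
  define F where "F s x = (SOME f. green_solution s x f)" for s x
  have F: "green_solution s x (F s x)" for s x
  proof -
    have "\<exists>f. green_solution s x f" using green_solution_exists by blast
    then show ?thesis unfolding F_def by (rule someI_ex)
  qed
  note unique = green_solution_unique[OF F]
  have F_int: "norm (green_integral (F s x) t) \<le>
      \<theta> * (K * exp (\<epsilon> * \<bar>s\<bar>) * norm x / (1 - \<theta>)) * exp (- \<gamma> * \<bar>t - s\<bar>)" for s x t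
  proof -
    obtain f where f: "green_solution s x f" "\<And>t. norm (green_integral f t) \<le>
      \<theta> * (K * exp (\<epsilon> * \<bar>s\<bar>) * norm x / (1 - \<theta>)) * exp (- \<gamma> * \<bar>t - s\<bar>)"
      using green_solution_exists by blast
    have "F s x = f" using unique[OF f(1)] by blast
    then show ?thesis using f(2) by simp
  qed
  have split: "a + \<theta> * (a / (1 - \<theta>)) = a / (1 - \<theta>)" for a :: real
    using \<theta>_less by (simp add: field_simps)
  have F_le: "norm (F s x t) \<le> K / (1 - \<theta>) * exp (- \<gamma> * \<bar>t - s\<bar> + \<epsilon> * \<bar>s\<bar>) * norm x" for s x t
  proof -
    let ?A = "K * exp (\<epsilon> * \<bar>s\<bar>) * norm x" and ?e = "exp (- \<gamma> * \<bar>t - s\<bar>)"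
    have "F s x t = G t s x + green_integral (F s x) t"
      using F unfolding green_solution_def by blast
    then have "norm (F s x t) \<le> ?A * ?e + \<theta> * (?A / (1 - \<theta>)) * ?e"
      using norm_triangle_mono[OF G_apply_le F_int] by metis
    also have "\<dots> = (?A + \<theta> * (?A / (1 - \<theta>))) * ?e" by (simp only: distrib_right)
    also have "\<dots> = K / (1 - \<theta>) * exp (- \<gamma> * \<bar>t - s\<bar> + \<epsilon> * \<bar>s\<bar>) * norm x"
      unfolding split exp_add by simp
    finally show ?thesis .
  qed
  have "bounded_linear (\<lambda>x. F s x t)" for s t
  proof (rule bounded_linear_intro)
    fix x y c
    have sol: "admissible (F s x)" "F s x t = G t s x + green_integral (F s x) t" for s x t
      using F[of s x] unfolding green_solution_def by blast+
    have "green_solution s (x + y) (\<lambda>t. F s x t + F s y t)"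
      unfolding green_solution_def green_integral_add[OF sol(1) sol(1)]
    proof (intro conjI allI admissible_add sol(1))
      fix t
      show "F s x t + F s y t = G t s (x + y) + (green_integral (F s x) t + green_integral (F s y) t)"
        unfolding blinfun.add_right sol(2)[of s x t] sol(2)[of s y t] by (simp only: add_ac)
    qed
    from unique[OF this] show "F s (x + y) t = F s x t + F s y t" .
    have "green_solution s (c *\<^sub>R x) (\<lambda>t. c *\<^sub>R F s x t)"
      unfolding green_solution_def green_integral_scaleR
    proof (intro conjI allI admissible_scaleR sol(1))
      fix t
      show "c *\<^sub>R F s x t = G t s (c *\<^sub>R x) + c *\<^sub>R green_integral (F s x) t"
        unfolding blinfun.scaleR_right sol(2)[of s x t] by (simp only: scaleR_add_right)
    qed
    from unique[OF this] show "F s (c *\<^sub>R x) t = c *\<^sub>R F s x t" .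
    show "norm (F s x t) \<le> norm x * (K / (1 - \<theta>) * exp (- \<gamma> * \<bar>t - s\<bar> + \<epsilon> * \<bar>s\<bar>))"
      using F_le by (simp only: mult.commute)
  qed
  then have F_eq: "perturbed_green t s x = F s x t" for t s x
    unfolding perturbed_green_def F_def by (simp add: bounded_linear_Blinfun_apply)
  show "green_solution s x (\<lambda>t. perturbed_green t s x)" unfolding F_eq using F[of s x] by simp
  show "norm (perturbed_green t s x) \<le> K / (1 - \<theta>) * exp (- \<gamma> * \<bar>t - s\<bar> + \<epsilon> * \<bar>s\<bar>) * norm x"
    unfolding F_eq by (rule F_le)
  let ?A = "K * exp (\<epsilon> * \<bar>s\<bar>) * norm x"
  have "F s x s = G s s x + green_integral (F s x) s"
    using F unfolding green_solution_def by blast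
  then have "norm (x - F s x s) \<le> norm (x - G s s x) + norm (green_integral (F s x) s)"
    by (metis diff_diff_eq norm_triangle_ineq4)
  also have "\<dots> \<le> ?A + \<theta> * (?A / (1 - \<theta>))"
    using id_minus_G_apply_le[of x s] F_int[of s x s] by simp
  finally show "norm (x - perturbed_green s s x) \<le> K / (1 - \<theta>) * exp (\<epsilon> * \<bar>s\<bar>) * norm x"
    unfolding F_eq split by simp
qed

lemma perturbed_green:
  shows admissible_perturbed_green: "admissible (\<lambda>t. perturbed_green t s x)"
    and perturbed_green_eq: "perturbed_green t s x = G t s x + green_integral (\<lambda>t. perturbed_green t s x) t"
    and perturbed_green_unique: "green_solution s x f \<Longrightarrow> perturbed_green t s x = f t"
  using perturbed_green_solution[of s x] green_solution_unique[OF perturbed_green_solution]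
  unfolding green_solution_def by blast+

lemma green_bound_perturbed: "green_bound perturbed_green (K / (1 - \<theta>)) \<gamma> \<epsilon>"
  unfolding green_bound_def
proof (intro conjI allI norm_blinfun_bound)
  fix s x
  show "norm ((id_blinfun - perturbed_green s s) x) \<le> K / (1 - \<theta>) * exp (\<epsilon> * \<bar>s\<bar>) * norm x"
    using id_minus_perturbed_green_le by (simp add: blinfun.diff_left)
qed (use perturbed_green_le K_pos \<theta>_less in auto)

section \<open>Recognising orbits of \<open>U\<close>\<close>

text \<open>A Gronwall argument for functions that are merely bounded with integrable integrand: the
  integral operator contracts under the weight \<open>exp (c * (v - r))\<close>.\<close>

lemma volterra_zero:
  fixes d :: "real \<Rightarrow> 'a"
  assumes bdd: "\<And>v. r \<le> v \<Longrightarrow> v \<le> t \<Longrightarrow> norm (d v) \<le> D"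
    and int: "\<And>v. r \<le> v \<Longrightarrow> v \<le> t \<Longrightarrow> (\<lambda>\<tau>. T v \<tau> (B \<tau> (d \<tau>))) integrable_on {r..v}"
    and eq: "\<And>v. r \<le> v \<Longrightarrow> v \<le> t \<Longrightarrow> d v = integral {r..v} (\<lambda>\<tau>. T v \<tau> (B \<tau> (d \<tau>)))"
    and v: "r \<le> v" "v \<le> t"
  shows "d v = 0"
proof -
  obtain M where M: "M > 0" "\<And>s v. r \<le> s \<Longrightarrow> s \<le> v \<Longrightarrow> v \<le> t \<Longrightarrow> norm (T v s) \<le> M"
    using T_bounded by blast
  obtain N where N: "N > 0" "\<And>v. r \<le> v \<Longrightarrow> v \<le> t \<Longrightarrow> norm (B v) \<le> N"
    using B_bounded by blast
  \<comment> \<open>Chosen so that \<open>M * N / c = 1 / 2\<close>: each pass through the integral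
    halves the weighted bound.\<close>
  define c where "c = 2 * (M * N)"
  have c: "c > 0" using M N by (simp add: c_def)
  have D: "D \<ge> 0" using bdd[of r] v by (auto intro: order_trans[OF norm_ge_zero])
  have "norm (d v) \<le> D / 2 ^ n * exp (c * (v - r))" if "r \<le> v" "v \<le> t" for n v
    using that
  proof (induction n arbitrary: v)
    case 0
    have "D * 1 \<le> D * exp (c * (v - r))" using D c 0 by (intro mult_left_mono) auto
    then show ?case using bdd[of v] 0 by simp
  next
    case (Suc n)
    let ?g = "\<lambda>\<tau>. (M * N * (D / 2 ^ n)) * exp (c * (\<tau> - r))"
    let ?P = "\<lambda>\<tau>. (D / 2 ^ Suc n) * exp (c * (\<tau> - r))"
    have P: "(?g has_integral (?P v - ?P r)) {r..v}"
    proof (rule fundamental_theorem_of_calculus)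
      fix \<tau>
      have "(?P has_real_derivative (D / 2 ^ Suc n) * (exp (c * (\<tau> - r)) * c)) (at \<tau> within {r..v})"
        by (auto intro!: derivative_eq_intros)
      then show "(?P has_vector_derivative ?g \<tau>) (at \<tau> within {r..v})"
        unfolding has_real_derivative_iff_has_vector_derivative[symmetric]
        by (simp add: c_def mult_ac)
    qed (use Suc in auto)
    have "norm (T v \<tau> (B \<tau> (d \<tau>))) \<le> ?g \<tau>" if "\<tau> \<in> {r..v}" for \<tau>
    proof -
      have "norm (T v \<tau> (B \<tau> (d \<tau>))) \<le> M * (N * (D / 2 ^ n * exp (c * (\<tau> - r))))"
        using Suc that M N
        by (intro order_trans[OF norm_blinfun] mult_mono) auto
      then show ?thesis by (simp add: mult_ac)
    qed
    then have "norm (d v) \<le> integral {r..v} ?g"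
      unfolding eq[OF Suc.prems]
      using int[OF Suc.prems] P by (intro integral_norm_bound_integral) auto
    also have "\<dots> = ?P v - ?P r" using P by (rule integral_unique)
    also have "\<dots> \<le> ?P v" using D by simp
    finally show ?case .
  qed
  then have "norm (d v) \<le> D * exp (c * (v - r)) * (1 / 2) ^ n" for n
    using v by (simp add: power_divide mult_ac)
  moreover have "(\<lambda>n. D * exp (c * (v - r)) * (1 / 2) ^ n) \<longlonglongrightarrow> D * exp (c * (v - r)) * 0"
    by (intro tendsto_intros LIMSEQ_realpow_zero) auto
  ultimately have "norm (d v) \<le> D * exp (c * (v - r)) * 0"
    by (intro LIMSEQ_le_const) auto
  then show ?thesis by simp
qed

lemma U_integrable:
  assumes "s \<le> t"
  shows "(\<lambda>\<tau>. T t \<tau> (B \<tau> (U \<tau> s x))) integrable_on {s..t}"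
proof (rule evolution_integrable[OF T_evolution])
  show "continuous_on {s..t} (\<lambda>\<tau>. B \<tau> (U \<tau> s x))"
    by (rule bounded_bilinear.continuous_on[OF bounded_bilinear_blinfun_apply])
      (auto intro: continuous_on_subset[OF B_continuous] continuous_on_subset[OF U(3)[of s x]])
qed

text \<open>The difference with the orbit of \<open>U\<close> solves the homogeneous Volterra
  equation. Asking for boundedness and integrability instead of continuity admits functions altered
  at one point.\<close>

lemma U_unique:
  fixes g :: "real \<Rightarrow> 'a"
  assumes bdd: "\<And>v. r \<le> v \<Longrightarrow> v \<le> t \<Longrightarrow> norm (g v) \<le> D"
    and int: "\<And>v. r \<le> v \<Longrightarrow> v \<le> t \<Longrightarrow> (\<lambda>\<tau>. T v \<tau> (B \<tau> (g \<tau>))) integrable_on {r..v}"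
    and eq: "\<And>v. r \<le> v \<Longrightarrow> v \<le> t \<Longrightarrow> g v = T v r x + integral {r..v} (\<lambda>\<tau>. T v \<tau> (B \<tau> (g \<tau>)))"
    and "r \<le> t"
  shows "g t = U t r x"
proof -
  define d where "d v = g v - U v r x" for v
  have "bounded ((\<lambda>v. U v r x) ` {r..t})"
    by (intro compact_imp_bounded compact_continuous_image continuous_on_subset[OF U(3)]) auto
  then obtain E where "\<forall>y\<in>(\<lambda>v. U v r x) ` {r..t}. norm y \<le> E"
    unfolding bounded_iff by blast
  then have E: "v \<in> {r..t} \<Longrightarrow> norm (U v r x) \<le> E" for v by blast
  have "d t = 0"
  proof (rule volterra_zero[of r t d "D + E"])
    fix v assume v: "r \<le> v" "v \<le> t"
    show "norm (d v) \<le> D + E"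
      using bdd[OF v] E[of v] v norm_triangle_ineq4[of "g v" "U v r x"] by (simp add: d_def)
    show "(\<lambda>\<tau>. T v \<tau> (B \<tau> (d \<tau>))) integrable_on {r..v}"
      unfolding d_def blinfun.diff_right using int[OF v] U_integrable[OF v(1)] by (rule integrable_diff)
    show "d v = integral {r..v} (\<lambda>\<tau>. T v \<tau> (B \<tau> (d \<tau>)))"
      unfolding d_def blinfun.diff_right
      using integral_diff[OF int[OF v] U_integrable[OF v(1)]] eq[OF v] U_eq[OF v(1), of x] by simp
  qed (use \<open>r \<le> t\<close> in auto)
  then show ?thesis by (simp add: d_def)
qed

section \<open>The three Green identities for \<open>U\<close>\<close>

text \<open>The equation for \<open>perturbed_green\<close> becomes a mild equation for
  \<open>T\<close> with a jump at \<open>s\<close>. On intervals that avoid the jump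
  \<open>U_unique\<close> applies at once; an interval across it is split at
  \<open>s\<close>.\<close>

lemma perturbed_green_evolution:
  assumes "r \<le> t"
  shows "perturbed_green t s x = U t r (perturbed_green r s x) + (if r < s \<and> s \<le> t then U t s x else 0)"
proof -
  let ?f = "\<lambda>t. perturbed_green t s x"
  obtain D where D: "D > 0" "\<And>t. norm (?f t) \<le> D"
    using admissible_bounded[OF admissible_perturbed_green] by blast
  have mild: "?f v = T v r (?f r) + (if r < s \<and> s \<le> v then T v s x else 0) +
      integral {r..v} (\<lambda>\<tau>. T v \<tau> (B \<tau> (?f \<tau>)))" if "r \<le> v" for r v
    using perturbed_green_eq[of v s x] perturbed_green_eq[of r s x] G(1)[OF that, of s x]
      green_integral_evolution(2)[OF admissible_perturbed_green that, of s x]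
    by (simp add: blinfun.add_right)
  have reg: "?f t = U t r (?f r)" if rt: "r \<le> t" and "\<not> (r < s \<and> s \<le> t)" for r t
  proof (rule U_unique[of r t ?f D])
    fix v assume v: "r \<le> v" "v \<le> t"
    show "?f v = T v r (?f r) + integral {r..v} (\<lambda>\<tau>. T v \<tau> (B \<tau> (?f \<tau>)))"
      using mild[OF v(1)] v that by auto
    show "(\<lambda>\<tau>. T v \<tau> (B \<tau> (?f \<tau>))) integrable_on {r..v}"
      by (rule green_integral_evolution(1)[OF admissible_perturbed_green v(1)])
  qed (use D rt in auto)
  have jump: "?f s - x = U s r (?f r)" if "r < s"
  proof -
    \<comment> \<open>Replacing the value at \<open>s\<close> by the left limit
      \<open>?f s - x\<close> removes the jump and leaves every integral unchanged.\<close>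
    define g where "g v = (if v = s then ?f s - x else ?f v)" for v
    have "g s = U s r (?f r)"
    proof (rule U_unique[of r s g "D + norm x"])
      fix v assume v: "r \<le> v" "v \<le> s"
      have "norm (?f s - x) \<le> D + norm x"
        using D(2)[of s] norm_triangle_ineq4[of "?f s" x] by simp
      moreover have "norm (?f v) \<le> D + norm x" using D(2)[of v] by (simp add: add_increasing2)
      ultimately show "norm (g v) \<le> D + norm x" by (simp add: g_def)
      show "(\<lambda>\<tau>. T v \<tau> (B \<tau> (g \<tau>))) integrable_on {r..v}"
        by (rule integrable_spike_finite[OF _ _ green_integral_evolution(1)[OF admissible_perturbed_green v(1), of s x], of "{s}"])
          (auto simp: g_def)
      have "integral {r..v} (\<lambda>\<tau>. T v \<tau> (B \<tau> (g \<tau>))) = integral {r..v} (\<lambda>\<tau>. T v \<tau> (B \<tau> (?f \<tau>)))"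
        by (rule integral_spike[of "{s}"]) (auto simp: g_def)
      then show "g v = T v r (?f r) + integral {r..v} (\<lambda>\<tau>. T v \<tau> (B \<tau> (g \<tau>)))"
        using mild[OF v(1)] v that by (auto simp: g_def T(1))
    qed (use that in auto)
    then show ?thesis by (simp add: g_def)
  qed
  show ?thesis
  proof (cases "r < s \<and> s \<le> t")
    case True
    then have "?f t = U t s (?f s)" using reg[of s t] by simp
    also have "?f s = U s r (?f r) + x" using jump True by (simp add: algebra_simps)
    also have "U t s (U s r (?f r) + x) = U t r (?f r) + U t s x"
      using True by (simp add: blinfun.add_right U(2))
    finally show ?thesis using True by simp
  next
    case False
    then show ?thesis using reg[OF assms False] by auto
  qed
qed

text \<open>\<open>k\<close> is the part of \<open>?f\<close> from \<open>s\<close> on when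
  \<open>t < s\<close>, and minus the part before \<open>s\<close> otherwise. In both cases its only
  jump is by \<open>w\<close> at \<open>s\<close>, so it must be the solution started there.\<close>

lemma perturbed_green_compose:
  "perturbed_green r s (perturbed_green s t x - (if s = t then x else 0)) =
    (of_bool (t < s) - of_bool (r < s)) *\<^sub>R perturbed_green r t x"
proof -
  let ?f = "\<lambda>\<tau>. perturbed_green \<tau> t x"
  let ?\<chi> = "\<lambda>\<tau>. of_bool (t < s) - of_bool (\<tau> < s) :: real"
  define w where "w = ?f s - (if s = t then x else 0)"
  define k where "k \<tau> = ?\<chi> \<tau> *\<^sub>R ?f \<tau>" for \<tau>
  note f = admissible_perturbed_green[of t x]
  have "k = (\<lambda>\<tau>. of_bool (t < s) *\<^sub>R ?f \<tau> - of_bool (\<tau> < s) *\<^sub>R ?f \<tau>)"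
    by (simp add: k_def[abs_def] scaleR_left_diff_distrib)
  then have k: "admissible k"
    by (simp only:) (intro admissible_diff admissible_cut admissible_scaleR f)
  have "k r = G r s w + green_integral k r" for r
  proof -
    let ?y = "\<lambda>\<tau>. B \<tau> (?f \<tau>)"
    let ?c = "\<lambda>\<tau>. of_bool (\<tau> < s) - of_bool (r < s) :: real"
    have "w = (G s t x - (if s = t then x else 0)) + green_integral ?f s"
      using perturbed_green_eq[of s t x] by (simp add: w_def)
    then have "G r s w = ?\<chi> r *\<^sub>R G r t x + G r s (green_integral ?f s)"
      using G(2)[of r s t x] by (simp add: blinfun.add_right)
    also have "G r s (green_integral ?f s) = integral UNIV (\<lambda>\<tau>. G r s (G s \<tau> (?y \<tau>)))"
      unfolding green_integral_def
      by (rule integral_apply_blinfun(2)[OF admissible_integrable[OF f], symmetric])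
    finally have 1: "G r s w = ?\<chi> r *\<^sub>R G r t x + integral UNIV (\<lambda>\<tau>. G r s (G s \<tau> (?y \<tau>)))" .
    have 2: "green_integral k r = integral UNIV (\<lambda>\<tau>. ?\<chi> \<tau> *\<^sub>R G r \<tau> (?y \<tau>))"
      unfolding green_integral_def k_def by (simp add: blinfun.scaleR_right)
    have int: "(\<lambda>\<tau>. G r s (G s \<tau> (?y \<tau>))) integrable_on UNIV" "(\<lambda>\<tau>. ?\<chi> \<tau> *\<^sub>R G r \<tau> (?y \<tau>)) integrable_on UNIV"
      using integral_apply_blinfun(1)[OF admissible_integrable[OF f]] admissible_integrable[OF k]
      by (simp_all add: k_def blinfun.scaleR_right)
    \<comment> \<open>By the second identity for \<open>G\<close> the terms
      \<open>of_bool (\<tau> < s)\<close> cancel. At \<open>\<tau> = s\<close> the identity contains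
      an additional term, so that point is left out.\<close>
    have "G r s (G s \<tau> (?y \<tau>)) + ?\<chi> \<tau> *\<^sub>R G r \<tau> (?y \<tau>) = ?\<chi> r *\<^sub>R G r \<tau> (?y \<tau>)" if "\<tau> \<noteq> s" for \<tau>
      using G(2)[of r s \<tau> "?y \<tau>"] that by (simp add: scaleR_left_diff_distrib)
    then have "integral UNIV (\<lambda>\<tau>. G r s (G s \<tau> (?y \<tau>)) + ?\<chi> \<tau> *\<^sub>R G r \<tau> (?y \<tau>)) =
        integral UNIV (\<lambda>\<tau>. ?\<chi> r *\<^sub>R G r \<tau> (?y \<tau>))"
      by (intro integral_spike[of "{s}"]) auto
    then have "G r s w + green_integral k r = ?\<chi> r *\<^sub>R G r t x + ?\<chi> r *\<^sub>R green_integral ?f r"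
      unfolding 1 2 using integral_add[OF int] by (simp add: green_integral_def)
    also have "\<dots> = k r"
      unfolding k_def using perturbed_green_eq[of r t x] by (simp add: scaleR_add_right)
    finally show ?thesis by simp
  qed
  with k have "green_solution s w k" unfolding green_solution_def by blast
  from perturbed_green_unique[OF this, of r] show ?thesis by (simp add: w_def k_def)
qed

text \<open>The solution \<open>f\<close> and the orbit piece \<open>v\<close> on
  \<open>[s, t)\<close> both jump by \<open>x\<close> at \<open>s\<close>. Their difference jumps
  only at \<open>t\<close>, where \<open>v\<close> drops from \<open>U t s x\<close> to 0; this is
  the solution started at \<open>t\<close> with that value.\<close>

lemma perturbed_green_U:
  assumes st: "s \<le> t"
  shows "perturbed_green r t (U t s x) = perturbed_green r s x - (if s \<le> r \<and> r < t then U r s x else 0)"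
proof -
  \<comment> \<open>The orbit frozen outside \<open>{s..t}\<close> is continuous and bounded, and
    two cuts turn it into \<open>v\<close>.\<close>
  define u where "u \<tau> = U (max s (min \<tau> t)) s x" for \<tau>
  define v where "v \<tau> = (if s \<le> \<tau> \<and> \<tau> < t then U \<tau> s x else 0)" for \<tau>
  define f where "f \<tau> = perturbed_green \<tau> s x" for \<tau>
  have f: "admissible f" unfolding f_def by (rule admissible_perturbed_green)
  have "continuous_on UNIV u"
    unfolding u_def by (rule continuous_on_compose2[OF U(3)[of s x]]) (auto intro!: continuous_intros)
  moreover obtain E where "\<And>\<tau>. norm (u \<tau>) \<le> E"
  proof -
    have "bounded ((\<lambda>v. U v s x) ` {s..t})"
      by (intro compact_imp_bounded compact_continuous_image continuous_on_subset[OF U(3)]) auto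
    then obtain E where E: "\<forall>y\<in>(\<lambda>v. U v s x) ` {s..t}. norm y \<le> E"
      unfolding bounded_iff by blast
    show ?thesis
      by (rule that[of E]) (use E st in \<open>auto simp: u_def\<close>)
  qed
  ultimately have "admissible u" by (rule admissible_continuous)
  moreover have "v = (\<lambda>\<tau>. of_bool (\<tau> < t) *\<^sub>R u \<tau> - of_bool (\<tau> < s) *\<^sub>R u \<tau>)"
    using st by (auto simp: v_def u_def fun_eq_iff)
  ultimately have v: "admissible v" by (simp only:) (intro admissible_diff admissible_cut)
  let ?y = "\<lambda>\<tau>. B \<tau> (U \<tau> s x)"
  have "v r = G r s x - G r t (U t s x) + green_integral v r" for r
  proof -
    have "((\<lambda>\<tau>. G r \<tau> (B \<tau> (v \<tau>))) has_integral green_integral v r) UNIV"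
      unfolding green_integral_def using admissible_integrable[OF v] by (rule integrable_integral)
    then have "((\<lambda>\<tau>. if \<tau> \<in> {s..t} then G r \<tau> (?y \<tau>) else 0) has_integral green_integral v r) UNIV"
      by (rule has_integral_spike_finite[of "{t}", rotated 2]) (auto simp: v_def)
    then have 1: "((\<lambda>\<tau>. G r \<tau> (?y \<tau>)) has_integral green_integral v r) {s..t}"
      by (simp only: has_integral_restrict_UNIV)
    \<comment> \<open>The extra term of the third identity, integrated; the equation for
      \<open>U\<close> on \<open>{s..r}\<close> evaluates it.\<close>
    let ?w = "if s \<le> r \<and> r < t then U r s x - T r s x else 0"
    have 2: "((\<lambda>\<tau>. if \<tau> \<le> r \<and> r < t then T r \<tau> (?y \<tau>) else 0) has_integral ?w) {s..t}"
    proof (cases "s \<le> r \<and> r < t")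
      case True
      then have "((\<lambda>\<tau>. T r \<tau> (?y \<tau>)) has_integral ?w) ({..r} \<inter> {s..t})"
        using integrable_integral[OF U_integrable[of s r x]] U_eq[of s r x] by (simp add: min_def)
      then have "((\<lambda>\<tau>. if \<tau> \<in> {..r} then T r \<tau> (?y \<tau>) else 0) has_integral ?w) {s..t}"
        by (simp only: has_integral_restrict_Int)
      then show ?thesis using True by simp
    next
      case False
      have "((\<lambda>\<tau>. 0) has_integral ?w) {s..t}" using False by auto
      then show ?thesis by (rule has_integral_eq[rotated]) (use False in auto)
    qed
    have "((\<lambda>\<tau>. G r t (T t \<tau> (?y \<tau>))) has_integral G r t (U t s x - T t s x)) {s..t}"
      using has_integral_linear[OF integrable_integral[OF U_integrable[OF st, of x]], of "blinfun_apply (G r t)"]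
        U_eq[OF st, of x] by (simp add: o_def blinfun.bounded_linear_right)
    \<comment> \<open>A second evaluation of the integral just computed, now through the third
      identity; equating the two values gives the equation for \<open>v\<close>.\<close>
    moreover have "((\<lambda>\<tau>. G r t (T t \<tau> (?y \<tau>))) has_integral (green_integral v r - ?w)) {s..t}"
      by (rule has_integral_eq[OF _ has_integral_diff[OF 1 2]]) (use G(3) in auto)
    ultimately have "G r t (U t s x - T t s x) = green_integral v r - ?w"
      by (rule has_integral_unique)
    then show ?thesis
      using G(3)[OF st, of r x] by (auto simp: v_def blinfun.diff_right algebra_simps split: if_splits)
  qed
  moreover have "f r = G r s x + green_integral f r" for r
    unfolding f_def by (rule perturbed_green_eq)
  ultimately have "f r - v r = G r t (U t s x) + green_integral (\<lambda>\<tau>. f \<tau> - v \<tau>) r" for r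
    unfolding green_integral_diff[OF f v] by simp
  then have "green_solution t (U t s x) (\<lambda>\<tau>. f \<tau> - v \<tau>)"
    unfolding green_solution_def using admissible_diff[OF f v] by blast
  from perturbed_green_unique[OF this, of r] show ?thesis by (simp add: f_def v_def)
qed

lemma green_function_perturbed: "green_function U perturbed_green"
  using perturbed_green_evolution perturbed_green_compose perturbed_green_U by (rule green_functionI)

lemma perturbed_dichotomy:
  "nonuniform_exp_dichotomy_wrt U (\<lambda>t. perturbed_green t t) (K / (1 - \<theta>)) \<gamma> \<epsilon>"
  using U_evolution green_function_perturbed green_bound_perturbed by (rule green_function_imp_dichotomy)

end

theorem theorem1:
  fixes T U :: "real \<Rightarrow> real \<Rightarrow> ('a::banach \<Rightarrow>\<^sub>L 'a)"
    and B :: "real \<Rightarrow> ('a \<Rightarrow>\<^sub>L 'a)"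
    and K \<alpha> \<epsilon> :: real
    and b :: "real \<Rightarrow> real"
  assumes "evolution_family T"
    and "continuous_on UNIV B"
    and "evolution_family U"
    and "\<And>t s x. s \<le> t \<Longrightarrow>
      blinfun_apply (U t s) x = blinfun_apply (T t s) x +
        integral {s..t} (\<lambda>\<tau>. blinfun_apply (T t \<tau>) (blinfun_apply (B \<tau>) (blinfun_apply (U \<tau> s) x)))"
    and "nonuniform_exp_dichotomy_consts T K \<alpha> \<epsilon>"
    and "\<And>t. b t = norm (B t) * exp (\<epsilon> * \<bar>t\<bar>)"
    and "ennreal (2 * K) * (SUP t. \<integral>\<^sup>+ s. ennreal (exp (- \<alpha> * \<bar>t - s\<bar>) * b s) \<partial>lborel) < 1"
  shows "admits_nonuniform_exp_dichotomy U"
proof -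
  let ?M = "SUP t. \<integral>\<^sup>+ s. ennreal (exp (- \<alpha> * \<bar>t - s\<bar>) * b s) \<partial>lborel"
  define \<gamma> where "\<gamma> = \<alpha> / 3"
  have K: "K > 0" and \<gamma>: "\<gamma> > 0" "\<alpha> = 3 * \<gamma>" and \<epsilon>: "\<epsilon> \<ge> 0"
    using assms(5) by (auto simp: nonuniform_exp_dichotomy_consts_def \<gamma>_def)
  obtain P where P: "nonuniform_exp_dichotomy_wrt T P K (3 * \<gamma>) \<epsilon>"
    using assms(5) \<gamma>(2) unfolding nonuniform_exp_dichotomy_consts_def by blast
  obtain G where G: "green_function T G" "green_bound G K (3 * \<gamma>) \<epsilon>"
    using dichotomy_imp_green_function[OF assms(1) P] .
  \<comment> \<open>An infinite supremum times the positive constant \<open>2 * K\<close> would be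
    infinite, against \<open>q < 1\<close>.\<close>
  have "?M \<noteq> top"
  proof
    assume M: "?M = top"
    have "ennreal (2 * K) * ?M = top"
      unfolding M using K by (simp add: ennreal_mult_eq_top_iff)
    then show False using assms(7) by simp
  qed
  then obtain M where M: "?M = ennreal M" "M \<ge> 0"
    by (intro that[of "enn2real ?M"] enn2real_nonneg ennreal_enn2real[symmetric] less_top[THEN iffD1])
  have "ennreal (2 * K * M) < ennreal 1"
    using assms(7) unfolding M(1) using K M(2) by (simp add: ennreal_mult)
  then have \<theta>: "2 * K * M < 1" using K M(2) by (subst (asm) ennreal_less_iff) auto
  have b: "continuous_on UNIV b"
    unfolding assms(6)[abs_def] by (intro continuous_intros assms(2))
  have b_nonneg: "b s \<ge> 0" for s by (simp add: assms(6))
  let ?k = "\<lambda>t \<tau>. exp (- (2 * \<gamma>) * \<bar>t - \<tau>\<bar>) * b \<tau>"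
  have kernel: "?k t integrable_on UNIV \<and> K * integral UNIV (?k t) \<le> 2 * K * M" for t
  proof -
    \<comment> \<open>The rate \<open>2 * \<gamma>\<close> is two thirds of \<open>\<alpha>\<close>,
      where the loss factor is exactly 2.\<close>
    have "(\<integral>\<^sup>+ s. ennreal (?k t s) \<partial>lborel) \<le> ennreal (1 + 2 * (\<alpha> - 2 * \<gamma>) / (2 * \<gamma>)) * ?M"
      by (rule exp_convolution_le)
        (use \<gamma> b b_nonneg in \<open>auto intro!: SUP_upper borel_measurable_continuous_onI\<close>)
    also have "1 + 2 * (\<alpha> - 2 * \<gamma>) / (2 * \<gamma>) = 2" using \<gamma> by simp
    also have "ennreal 2 * ?M = ennreal (2 * M)" unfolding M(1) using M(2) by (simp add: ennreal_mult)
    finally have le: "(\<integral>\<^sup>+ s. ennreal (?k t s) \<partial>lborel) \<le> ennreal (2 * M)" .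
    then obtain I where I: "(\<integral>\<^sup>+ s. ennreal (?k t s) \<partial>lborel) = ennreal I" "I \<ge> 0"
      by (intro that[of "enn2real (\<integral>\<^sup>+ s. ennreal (?k t s) \<partial>lborel)"] enn2real_nonneg
          ennreal_enn2real[symmetric] le_less_trans[OF le ennreal_less_top])
    have "(?k t has_integral I) UNIV"
      by (rule nn_integral_has_integral[OF _ _ I])
        (use b b_nonneg in \<open>auto intro!: borel_measurable_continuous_onI continuous_intros\<close>)
    moreover have "I \<le> 2 * M" using le M(2) unfolding I(1) by simp
    ultimately show ?thesis using K by (auto simp: has_integral_iff)
  qed
  \<comment> \<open>After the doubling the contraction constant is \<open>q\<close> itself.\<close>
  interpret green_perturbation T U G B K \<gamma> \<epsilon> "2 * K * M"
    using assms(1-4) G K \<gamma>(1) \<theta> kernel[unfolded assms(6)] by unfold_locales auto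
  have "K / (1 - 2 * K * M) > 0" using K \<theta> by simp
  then show ?thesis
    using perturbed_dichotomy \<gamma>(1) \<epsilon>
    unfolding admits_nonuniform_exp_dichotomy_def nonuniform_exp_dichotomy_consts_def by blast
qed

end
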